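(* Let $E=(\Phi_{BV},\Phi_{IA},I)$ be a theory-modular encoding (containing no query) and let $\chi_q=\forall\bar y_{q^{BV}}.\ (\phi_q[\bar y_{q^{BV}}]\wedge q^{BV}(\bar y_{q^{BV}}))\to\bot$ be a $\Sigma_{BV}$-query, with $\phi_q\in QF_{BV}$ and $q^{BV}\in\Pi^{BV}$. If the procedure $\mathrm{Solve}$ run on $E$ and $\chi_q$ returns SAT (resp. UNSAT), then $(\Phi_{BV}\cup\{\chi_q\},\Phi_{IA},I)$ is satisfiable (resp. unsatisfiable) modulo $(T_{BV},T_{IA})$.
   Context: **Theories.** $\Sigma_{BV}$ is the many-sorted first-order signature of SMT-LIB fixed-size bit-vectors: a sort $BV_n$ for each $n\ge 1$; predicates: equality, unsigned and signed comparisons; functions: a constant for every bit-vector, and the usual arithmetic, bitwise, shift, extraction and concatenation operators. $\Sigma_{IA}$ is the signature of integer arithmetic: one sort $Int$, predicates $=,<,\le$, a constant for every integer, and $+,-,\cdot,\mathrm{div},\mathrm{mod}$. $T_{BV}$ and $T_{IA}$ are the corresponding SMT-LIB theories, with fixed standard models $M_{BV}$ (the domain of $BV_n$ is the finite set of all bit-vectors of width $n$) and $M_{IA}$ (domain $\mathbb{Z}$). Satisfiability and validity modulo $T_{BV}$ (resp. $T_{IA}$) are understood with respect to $M_{BV}$ (resp. $M_{IA}$). $QF_{BV}$, $QF_{IA}$ are the classes of quantifier-free formulas over $\Sigma_{BV}$, $\Sigma_{IA}$. For a formula $\varphi$ with free variables $\bar x$ and a structure $M$, $[\![\varphi]\!]_M$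 is the set of value tuples for $\bar x$ satisfying $\varphi$ in $M$. $D_{\bar x}$ denotes the product of the domains in $M_{BV}$ of the sorts of the bit-vector variables $\bar x$. **CHCs.** Let $\Pi$ be a set of fresh (uninterpreted) predicate symbols typed over the sorts of a signature $\Sigma$. A CHC over $\Sigma\cup\Pi$ is a sentence $\forall\bar x.\ (\phi[\bar x]\wedge\bigwedge_j p_j(\bar x_{p_j}))\to H$, where $\phi$ is a quantifier-free $\Sigma$-formula (the constraint) in which all variables of $\bar x$ appear, $p_j\in\Pi$ (repetitions allowed), $\bar x_{p_j}\subseteq\bar x$, and the head $H$ is either $h(\bar x_h)$ with $h\in\Pi$, $\bar x_h\subseteq\bar x$ (a rule; a fact if there are no $p_j$), or $\bot$ (a query). The left-hand side is the body. **Single-theory semantics and solutions.** For a set $\Psi$ of CHCs over $\Sigma_a\cup\Pi$ ($a\in\{BV,IA\}$), the semantics of $p\in\Pi$ in $\Psi$ is $\bigcup_n S^n(p)$, where $S^n(p)$ is the union, over all rules $\forall\bar x.\,B\to p(\bar x_p)$ in $\Psi$, of the set of values of $\bar x_p$ under assignments satisfying $B$ in the expansion of $M_a$ interpreting each $q\in\Pi$ as $\emptyset$ if $n=0$ and as $S^{n-1}(q)$ if $n>0$. $\Psi$ is satisfiable modulo $T_a$ if all its queries hold in the expansion of $M_a$ interpreting each $p$ by its semantics. A $\Sigma_a$-interpretation $J$ assigns to each $p\in\Pi$ a quantifier-free $\Sigma_a$-formula $J(p)$ with free variables in a fixed tuple $\bar y_p$ (of the sorts of $p$); $J\models_{T_a}\Psi$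 means that for each CHC in $\Psi$, replacing each application $p(\bar x_p)$ by $J(p)[\bar y_p\mapsto\bar x_p]$ gives a formula valid modulo $T_a$. $\Psi\vdash_{T_a}\bot$ with refutation $\pi$ means that $\Psi$ is unsatisfiable modulo $T_a$ and $\pi$ is a derivation tree of $\bot$ from $\Psi$: its root is $\bot$, and every other node is labeled $\langle r,\psi\rangle$ with $r\in\Pi$ and $\psi$ a quantifier-free $\Sigma_a$-formula over $\bar y_r$ that is satisfiable and such that $[\![\psi]\!]_{M_a}$ is contained in the semantics of $r$ in $\Psi$; leaves are derived from facts of $\Psi$; and if the only query of $\Psi$ has body $\phi\wedge p(\bar y_p)\wedge\cdots$, the root has a single child $\langle p,\psi\rangle$, and it satisfies that $\psi\wedge\phi$ is satisfiable modulo $T_a$. **Transformers.** Let $\Phi$ be a set of CHCs over $\Sigma_{BV}\cup\Pi$. A fixed bijection $x\mapsto x'$ maps bit-vector variables to integer variables. Each bit-vector variable $x$ of sort $BV_n$ has a domain transformer $\delta_x$, an injective map from the set of bit-vectors of width $n$ to $\mathbb{Z}$; it is required that all variables appearing in the same argument position of an uninterpreted predicate $p$ in $\Phi$ (and the corresponding variable of $\bar y_{p^{BV}}$) have the same domain transformer. $\delta_{\bar x}$ acts componentwise on tuples and elementwise on sets; $\delta_p=\delta_{\bar x_p}$ for any application $p(\bar x_p)$; $\delta^{-1}$ denotes preimage. $\rho(x')$ is the $\Sigma_{IA}$-constraint (domain restriction) expressing that $x'$ lies in the image of $\delta_x$. A theory transformer $\tau_{BV\to IA}$ maps every $\varphi\in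 QF_{BV}$ with free variables $\bar x$ to a $QF_{IA}$ formula with free variables $\bar x'$ such that $[\![\varphi]\!]_{M_{BV}}=\delta_{\bar x}^{-1}\big([\![\tau_{BV\to IA}(\varphi)]\!]_{M_{IA}}\cap\delta_{\bar x}(D_{\bar x})\big)$. A theory transformer $\tau_{IA\to BV}$ maps every $\varphi'\in QF_{IA}$ with free variables $\bar x'$ to a $QF_{BV}$ formula with free variables $\bar x$ such that $[\![\tau_{IA\to BV}(\varphi')]\!]_{M_{BV}}=\delta_{\bar x}^{-1}\big([\![\varphi']\!]_{M_{IA}}\cap\delta_{\bar x}(D_{\bar x})\big)$. Both transformers are fixed. **Theory-modular encoding.** Given $\Delta_{BV}\subseteq\Phi$, $\Delta_{IA}=\Phi\setminus\Delta_{BV}$, the encoding of $\Phi$ is $E=(\Phi_{BV},\Phi_{IA},I)$, where, with fresh copies $\Pi^{BV}=\{p^{BV}:p\in\Pi\}$ (same types) and $\Pi^{IA}=\{p^{IA}:p\in\Pi\}$ (all arguments of sort $Int$): - $\Phi_{BV}$ is obtained from $\Delta_{BV}$ by replacing each $p$ by $p^{BV}$. - $\Phi_{IA}$ is obtained from $\Delta_{IA}$ by replacing each CHC $\forall\bar x.\,(\phi\wedge\bigwedge_j p_j(\bar x_{p_j}))\to h(\bar x_h)$ by $\forall\bar x'.\,(\tau_{BV\to IA}(\phi)\wedge\bigwedge_j p_j^{IA}(\bar x'_{p_j})\wedge\bigwedge_{x\in\bar y}\rho(x'))\to h^{IA}(\bar x'_h)$, where $\bar y=\bar x\setminus\bigcup_j\bar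 x_{p_j}$; a head $\bot$ is left unchanged. - $I=I_{BV}\cup I_{IA}$: $I_{BV}$ consists of all pairs $(p^{BV},p^{IA})$ such that $p^{BV}$ is the head predicate of some CHC in $\Phi_{BV}$ and $p^{IA}$ occurs in the body of some CHC in $\Phi_{IA}$; $I_{IA}$ consists of all pairs $(p^{IA},p^{BV})$ such that $p^{IA}$ is the head predicate of some CHC in $\Phi_{IA}$ and $p^{BV}$ occurs in the body of some CHC in $\Phi_{BV}$. **Semantics of the encoding.** (The same definitions apply to $(\Phi_{BV}\cup\{\chi_q\},\Phi_{IA},I)$.) For $\{a,b\}=\{BV,IA\}$, $p^a\in\Pi^a$ and $n\in\mathbb{N}$: $[\![p^a]\!]^n=L^n(p^a)\cup X^n(p^a)$. The local part $L^n(p^a)$ is the union, over all rules $\forall\bar x.\,B\to p^a(\bar x_{p^a})$ in $\Phi_a$, of the set of values of $\bar x_{p^a}$ under assignments satisfying $B$ in the expansion of $M_a$ interpreting every $q^a\in\Pi^a$ as $\emptyset$ if $n=0$ and as $[\![q^a]\!]^{n-1}$ if $n>0$. The external part $X^n(p^a)$ is $\emptyset$ if $n=0$ or $(p^b,p^a)\notin I$; otherwise it is $\delta_p([\![p^{BV}]\!]^{n-1})$ if $a=IA$, and $\delta_p^{-1}([\![p^{IA}]\!]^{n-1})$ if $a=BV$. Set $[\![p^a]\!]=\bigcup_n[\![p^a]\!]^n$. The triple is satisfiable modulo $(T_{BV},T_{IA})$ if for each $a$, every query of the $a$-fragment is true in the expansion of $M_a$ interpreting each $p^a$ as $[\![p^a]\!]$;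 otherwise it is unsatisfiable. **The procedure Solve.** It is a (nondeterministic) transition system. A state is a triple $(Q,U,O)$ where $Q$ is a finite set of proof obligations $(p^a,\phi)$ ($p^a\in\Pi^a$, $\phi$ a quantifier-free $\Sigma_a$-formula over $\bar y_{p^a}$), and $U$, $O$ are sets of lemmas $(p^a,\psi)$ of the same shape; here $\bar y_{p^{IA}}=\bar y'_{p^{BV}}$. Write $\tau_a$ for the theory transformer from $a$ to the other theory $b$. Let $R_{IA}(\bar y)=\bigwedge_{y'\in\bar y}\rho(y')$ and $R_{BV}(\bar y)=\top$. For $\{a,b\}=\{BV,IA\}$ put - $\Phi_a^{O}=\Phi_a\cup\{\forall\bar y_{s^a}.\,(\bigwedge_{(s^a,\psi)\in O}\psi\wedge R_a(\bar y_{s^a}))\to s^a(\bar y_{s^a}) : (s^b,s^a)\in I\}$, - $\Phi_a^{U}=\Phi_a\cup\{\forall\bar y_{s^a}.\,(\bigvee_{(s^a,\psi)\in U}\psi\wedge R_a(\bar y_{s^a}))\to s^a(\bar y_{s^a}) : (s^b,s^a)\in I\}$ (the disjunction is over lemmas and is conjoined with $R_a$; the empty conjunction is $\top$, the empty disjunction is $\bot$), - $\mathrm{Query}(p^a,\phi)=\{\forall\bar y_{p^a}.\,(\phi\wedge p^a(\bar y_{p^a})\wedge R_a(\bar y_{p^a}))\to\bot\}$. Rules: - Init: the initial state is $(\{(q^{BV},\phi_q)\},\emptyset,\emptyset)$. - NegAnswer: if $(p^a,\phi)\in Q\setminus\{(q^{BV},\phi_q)\}$ and $J\models_{T_a}\Phi_a^{O}\cup\mathrm{Query}(p^a,\phi)$,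 move to $(Q\setminus\{(p^a,\phi)\},\,U,\,O\cup\{(p^b,\tau_a(J(p^a)))\})$. - PosAnswer: if $(p^a,\phi)\in Q\setminus\{(q^{BV},\phi_q)\}$ and $\Phi_a^{U}\cup\mathrm{Query}(p^a,\phi)\vdash_{T_a}\bot$ with refutation $\pi$ whose root has child $\langle p^a,\psi\rangle$, move to $(Q\setminus\{(p^a,\phi)\},\,U\cup\{(p^b,\tau_a(\psi))\},\,O)$. - Query: if $(p^a,\phi)\in Q$, some $J\models_{T_a}\Phi_a^{U}\cup\mathrm{Query}(p^a,\phi)$, and $\Phi_a^{O}\cup\mathrm{Query}(p^a,\phi)\vdash_{T_a}\bot$ with a refutation having a leaf $\langle r^a,\psi\rangle$ with $(r^b,r^a)\in I$, move to $(Q\cup\{(r^b,\tau_a(\psi))\},U,O)$. - Sat: from a state $(\{(q^{BV},\phi_q)\},U,O)$ such that some $J\models_{T_{BV}}\Phi_{BV}^{O}\cup\mathrm{Query}(q^{BV},\phi_q)$, return SAT. - Unsat: from a state $(\{(q^{BV},\phi_q)\},U,O)$ such that $\Phi_{BV}^{U}\cup\mathrm{Query}(q^{BV},\phi_q)\vdash_{T_{BV}}\bot$, return UNSAT. *)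

theory Defs
  imports Main
begin

section \<open>The signatures of bit-vectors and integers\<close>

datatype thy = BV | IA

fun other :: "thy \<Rightarrow> thy" where
  "other BV = IA"
| "other IA = BV"

datatype sort = BVSort nat | IntSort

fun sort_of_thy :: "thy \<Rightarrow> sort \<Rightarrow> bool" where
  "sort_of_thy BV (BVSort n) = (n \<ge> 1)"
| "sort_of_thy IA IntSort = True"
| "sort_of_thy _ _ = False"

datatype bv_unop = BvNot | BvNeg

datatype bv_binop =
    BvAnd | BvOr | BvXor | BvNand | BvNor | BvXnor
  | BvAdd | BvSub | BvMul | BvUdiv | BvUrem | BvSdiv | BvSrem | BvSmod
  | BvShl | BvLshr | BvAshr

datatype bv_cmp = BvUlt | BvUle | BvUgt | BvUge | BvSlt | BvSle | BvSgt | BvSge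

datatype int_binop = IntAdd | IntSub | IntMul | IntDiv | IntMod

text \<open>
  The symbols of both signatures live in one datatype; the natural number arguments are the
  widths of the operands, preceded by the SMT-LIB indices of the indexed operators.
  Bit-vectors are lists of bits, least significant bit first.
\<close>

datatype fsym =
    BvConst "bool list"
  | BvUn bv_unop nat
  | BvBin bv_binop nat
  | BvComp nat
  | BvConcat nat nat
  | BvExtract nat nat nat
  | BvRepeat nat nat
  | BvZeroExtend nat nat
  | BvSignExtend nat nat
  | BvRotateLeft nat nat
  | BvRotateRight nat nat
  | IntConst int
  | IntBin int_binop

datatype psym = Eq sort | BvCmp bv_cmp nat | IntLt | IntLe

primrec fargs :: "fsym \<Rightarrow> sort list" where
  "fargs (BvConst bs) = []"
| "fargs (BvUn u n) = [BVSort n]"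
| "fargs (BvBin b n) = [BVSort n, BVSort n]"
| "fargs (BvComp n) = [BVSort n, BVSort n]"
| "fargs (BvConcat m n) = [BVSort m, BVSort n]"
| "fargs (BvExtract i j n) = [BVSort n]"
| "fargs (BvRepeat i n) = [BVSort n]"
| "fargs (BvZeroExtend i n) = [BVSort n]"
| "fargs (BvSignExtend i n) = [BVSort n]"
| "fargs (BvRotateLeft i n) = [BVSort n]"
| "fargs (BvRotateRight i n) = [BVSort n]"
| "fargs (IntConst k) = []"
| "fargs (IntBin b) = [IntSort, IntSort]"

primrec fres :: "fsym \<Rightarrow> sort" where
  "fres (BvConst bs) = BVSort (length bs)"
| "fres (BvUn u n) = BVSort n"
| "fres (BvBin b n) = BVSort n"
| "fres (BvComp n) = BVSort 1"
| "fres (BvConcat m n) = BVSort (m + n)"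
| "fres (BvExtract i j n) = BVSort (i - j + 1)"
| "fres (BvRepeat i n) = BVSort (i * n)"
| "fres (BvZeroExtend i n) = BVSort (n + i)"
| "fres (BvSignExtend i n) = BVSort (n + i)"
| "fres (BvRotateLeft i n) = BVSort n"
| "fres (BvRotateRight i n) = BVSort n"
| "fres (IntConst k) = IntSort"
| "fres (IntBin b) = IntSort"

primrec pargs :: "psym \<Rightarrow> sort list" where
  "pargs (Eq s) = [s, s]"
| "pargs (BvCmp c n) = [BVSort n, BVSort n]"
| "pargs IntLt = [IntSort, IntSort]"
| "pargs IntLe = [IntSort, IntSort]"

definition fsym_of_thy :: "thy \<Rightarrow> fsym \<Rightarrow> bool" where
  "fsym_of_thy a f \<longleftrightarrow> list_all (sort_of_thy a) (fres f # fargs f) \<and>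
     (case f of BvExtract i j n \<Rightarrow> j \<le> i \<and> i < n | _ \<Rightarrow> True)"

definition psym_of_thy :: "thy \<Rightarrow> psym \<Rightarrow> bool" where
  "psym_of_thy a p \<longleftrightarrow> list_all (sort_of_thy a) (pargs p)"


section \<open>The standard models\<close>

text \<open>The SMT-LIB conversions between bit-vectors and natural numbers.\<close>

definition bv2nat :: "bool list \<Rightarrow> nat" where
  "bv2nat bs = horner_sum of_bool 2 bs"

definition nat2bv :: "nat \<Rightarrow> nat \<Rightarrow> bool list" where
  "nat2bv n k = map (bit k) [0..<n]"

abbreviation msb :: "bool list \<Rightarrow> bool" where
  "msb bs \<equiv> last bs"

definition bvnot :: "bool list \<Rightarrow> bool list" where
  "bvnot s = map Not s"

definition bvneg :: "bool list \<Rightarrow> bool list" where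
  "bvneg s = nat2bv (length s) (2 ^ length s - bv2nat s)"

definition bvadd :: "bool list \<Rightarrow> bool list \<Rightarrow> bool list" where
  "bvadd s t = nat2bv (length s) (bv2nat s + bv2nat t)"

definition bvudiv :: "bool list \<Rightarrow> bool list \<Rightarrow> bool list" where
  "bvudiv s t = (if bv2nat t = 0 then replicate (length s) True
     else nat2bv (length s) (bv2nat s div bv2nat t))"

definition bvurem :: "bool list \<Rightarrow> bool list \<Rightarrow> bool list" where
  "bvurem s t = (if bv2nat t = 0 then s else nat2bv (length s) (bv2nat s mod bv2nat t))"

definition bvsdiv :: "bool list \<Rightarrow> bool list \<Rightarrow> bool list" where
  "bvsdiv s t =
    (if \<not> msb s \<and> \<not> msb t then bvudiv s t
     else if msb s \<and> \<not> msb t then bvneg (bvudiv (bvneg s) t)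
     else if \<not> msb s \<and> msb t then bvneg (bvudiv s (bvneg t))
     else bvudiv (bvneg s) (bvneg t))"

definition bvsrem :: "bool list \<Rightarrow> bool list \<Rightarrow> bool list" where
  "bvsrem s t =
    (if \<not> msb s \<and> \<not> msb t then bvurem s t
     else if msb s \<and> \<not> msb t then bvneg (bvurem (bvneg s) t)
     else if \<not> msb s \<and> msb t then bvurem s (bvneg t)
     else bvneg (bvurem (bvneg s) (bvneg t)))"

definition bvsmod :: "bool list \<Rightarrow> bool list \<Rightarrow> bool list" where
  "bvsmod s t =
    (let u = bvurem (if msb s then bvneg s else s) (if msb t then bvneg t else t)
     in if bv2nat u = 0 then u
        else if \<not> msb s \<and> \<not> msb t then u
        else if msb s \<and> \<not> msb t then bvadd (bvneg u) t
        else if \<not> msb s \<and> msb t then bvadd u t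
        else bvneg u)"

definition bvlshr :: "bool list \<Rightarrow> bool list \<Rightarrow> bool list" where
  "bvlshr s t = nat2bv (length s) (bv2nat s div 2 ^ bv2nat t)"

primrec bv_unop_sem :: "bv_unop \<Rightarrow> bool list \<Rightarrow> bool list" where
  "bv_unop_sem BvNot s = bvnot s"
| "bv_unop_sem BvNeg s = bvneg s"

primrec bv_binop_sem :: "bv_binop \<Rightarrow> bool list \<Rightarrow> bool list \<Rightarrow> bool list" where
  "bv_binop_sem BvAnd s t = map2 (\<and>) s t"
| "bv_binop_sem BvOr s t = map2 (\<or>) s t"
| "bv_binop_sem BvXor s t = map2 (\<noteq>) s t"
| "bv_binop_sem BvNand s t = bvnot (map2 (\<and>) s t)"
| "bv_binop_sem BvNor s t = bvnot (map2 (\<or>) s t)"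
| "bv_binop_sem BvXnor s t = map2 (=) s t"
| "bv_binop_sem BvAdd s t = bvadd s t"
| "bv_binop_sem BvSub s t = bvadd s (bvneg t)"
| "bv_binop_sem BvMul s t = nat2bv (length s) (bv2nat s * bv2nat t)"
| "bv_binop_sem BvUdiv s t = bvudiv s t"
| "bv_binop_sem BvUrem s t = bvurem s t"
| "bv_binop_sem BvSdiv s t = bvsdiv s t"
| "bv_binop_sem BvSrem s t = bvsrem s t"
| "bv_binop_sem BvSmod s t = bvsmod s t"
| "bv_binop_sem BvShl s t = nat2bv (length s) (bv2nat s * 2 ^ bv2nat t)"
| "bv_binop_sem BvLshr s t = bvlshr s t"
| "bv_binop_sem BvAshr s t = (if msb s then bvnot (bvlshr (bvnot s) t) else bvlshr s t)"

definition bvult :: "bool list \<Rightarrow> bool list \<Rightarrow> bool" where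
  "bvult s t \<longleftrightarrow> bv2nat s < bv2nat t"

definition bvslt :: "bool list \<Rightarrow> bool list \<Rightarrow> bool" where
  "bvslt s t \<longleftrightarrow> msb s \<and> \<not> msb t \<or> msb s = msb t \<and> bvult s t"

primrec bv_cmp_sem :: "bv_cmp \<Rightarrow> bool list \<Rightarrow> bool list \<Rightarrow> bool" where
  "bv_cmp_sem BvUlt s t = bvult s t"
| "bv_cmp_sem BvUle s t = (\<not> bvult t s)"
| "bv_cmp_sem BvUgt s t = bvult t s"
| "bv_cmp_sem BvUge s t = (\<not> bvult s t)"
| "bv_cmp_sem BvSlt s t = bvslt s t"
| "bv_cmp_sem BvSle s t = (\<not> bvslt t s)"
| "bv_cmp_sem BvSgt s t = bvslt t s"
| "bv_cmp_sem BvSge s t = (\<not> bvslt s t)"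

text \<open>
  Integer division is the Euclidean one of SMT-LIB (remainder between \<open>0\<close> and the absolute
  value of the divisor), which differs from \<open>div\<close> on \<open>int\<close> for negative divisors.
  SMT-LIB leaves division by zero open; the model fixed here has \<open>m div 0 = 0\<close> and
  \<open>m mod 0 = m\<close>.
\<close>

primrec int_binop_sem :: "int_binop \<Rightarrow> int \<Rightarrow> int \<Rightarrow> int" where
  "int_binop_sem IntAdd m n = m + n"
| "int_binop_sem IntSub m n = m - n"
| "int_binop_sem IntMul m n = m * n"
| "int_binop_sem IntDiv m n = sgn n * (m div \<bar>n\<bar>)"
| "int_binop_sem IntMod m n = m mod \<bar>n\<bar>"

text \<open>
  The two signatures share no sort, so both standard models are reducts of a single structure.
  It is this structure that interprets the terms and formulas below; restricting to formulas of
  one signature yields satisfiability and validity modulo the respective theory.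
\<close>

datatype val = BVal (bits: "bool list") | IVal (ival: int)

fun dom_of :: "sort \<Rightarrow> val set" where
  "dom_of (BVSort n) = {BVal bs | bs. length bs = n}"
| "dom_of IntSort = range IVal"

primrec fsem :: "fsym \<Rightarrow> val list \<Rightarrow> val" where
  "fsem (BvConst bs) vs = BVal bs"
| "fsem (BvUn u n) vs = BVal (bv_unop_sem u (bits (vs ! 0)))"
| "fsem (BvBin b n) vs = BVal (bv_binop_sem b (bits (vs ! 0)) (bits (vs ! 1)))"
| "fsem (BvComp n) vs = BVal [bits (vs ! 0) = bits (vs ! 1)]"
| "fsem (BvConcat m n) vs = BVal (bits (vs ! 1) @ bits (vs ! 0))"
| "fsem (BvExtract i j n) vs = BVal (take (i - j + 1) (drop j (bits (vs ! 0))))"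
| "fsem (BvRepeat i n) vs = BVal (concat (replicate i (bits (vs ! 0))))"
| "fsem (BvZeroExtend i n) vs = BVal (bits (vs ! 0) @ replicate i False)"
| "fsem (BvSignExtend i n) vs = BVal (bits (vs ! 0) @ replicate i (msb (bits (vs ! 0))))"
| "fsem (BvRotateLeft i n) vs = BVal (rev (rotate i (rev (bits (vs ! 0)))))"
| "fsem (BvRotateRight i n) vs = BVal (rotate i (bits (vs ! 0)))"
| "fsem (IntConst k) vs = IVal k"
| "fsem (IntBin b) vs = IVal (int_binop_sem b (ival (vs ! 0)) (ival (vs ! 1)))"

primrec psem :: "psym \<Rightarrow> val list \<Rightarrow> bool" where
  "psem (Eq s) vs = (vs ! 0 = vs ! 1)"
| "psem (BvCmp c n) vs = bv_cmp_sem c (bits (vs ! 0)) (bits (vs ! 1))"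
| "psem IntLt vs = (ival (vs ! 0) < ival (vs ! 1))"
| "psem IntLe vs = (ival (vs ! 0) \<le> ival (vs ! 1))"


section \<open>Quantifier-free formulas\<close>

datatype var = Var (vname: nat) (vsort: sort)

text \<open>
  Terms and formulas are polymorphic in the variables, so that \<open>set_fm\<close> is the set of free
  variables and \<open>map_fm\<close> is simultaneous substitution of variables for variables.
\<close>

datatype 'v trm = V 'v | Fn fsym "'v trm list"

datatype 'v fm =
    Top
  | Bot
  | Atom psym "'v trm list"
  | Neg "'v fm"
  | Conj "'v fm" "'v fm"
  | Disj "'v fm" "'v fm"
  | Imp "'v fm" "'v fm"

type_synonym form = "var fm"

primrec trm_sort :: "var trm \<Rightarrow> sort" where
  "trm_sort (V x) = vsort x"
| "trm_sort (Fn f ts) = fres f"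

primrec wf_trm :: "thy \<Rightarrow> var trm \<Rightarrow> bool" where
  "wf_trm a (V x) = sort_of_thy a (vsort x)"
| "wf_trm a (Fn f ts) = (fsym_of_thy a f \<and> map trm_sort ts = fargs f \<and> list_all (wf_trm a) ts)"

text \<open>\<open>qf BV\<close> and \<open>qf IA\<close> are the classes of well-sorted formulas over either signature.\<close>

primrec qf :: "thy \<Rightarrow> form \<Rightarrow> bool" where
  "qf a Top = True"
| "qf a Bot = True"
| "qf a (Atom p ts) = (psym_of_thy a p \<and> map trm_sort ts = pargs p \<and> list_all (wf_trm a) ts)"
| "qf a (Neg \<phi>) = qf a \<phi>"
| "qf a (Conj \<phi> \<psi>) = (qf a \<phi> \<and> qf a \<psi>)"
| "qf a (Disj \<phi> \<psi>) = (qf a \<phi> \<and> qf a \<psi>)"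
| "qf a (Imp \<phi> \<psi>) = (qf a \<phi> \<and> qf a \<psi>)"

primrec eval_trm :: "('v \<Rightarrow> val) \<Rightarrow> 'v trm \<Rightarrow> val" where
  "eval_trm \<sigma> (V x) = \<sigma> x"
| "eval_trm \<sigma> (Fn f ts) = fsem f (map (eval_trm \<sigma>) ts)"

primrec eval :: "('v \<Rightarrow> val) \<Rightarrow> 'v fm \<Rightarrow> bool" where
  "eval \<sigma> Top = True"
| "eval \<sigma> Bot = False"
| "eval \<sigma> (Atom p ts) = psem p (map (eval_trm \<sigma>) ts)"
| "eval \<sigma> (Neg \<phi>) = (\<not> eval \<sigma> \<phi>)"
| "eval \<sigma> (Conj \<phi> \<psi>) = (eval \<sigma> \<phi> \<and> eval \<sigma> \<psi>)"
| "eval \<sigma> (Disj \<phi> \<psi>) = (eval \<sigma> \<phi> \<or> eval \<sigma> \<psi>)"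
| "eval \<sigma> (Imp \<phi> \<psi>) = (eval \<sigma> \<phi> \<longrightarrow> eval \<sigma> \<psi>)"

definition assignment :: "(var \<Rightarrow> val) \<Rightarrow> bool" where
  "assignment \<sigma> \<longleftrightarrow> (\<forall>x. \<sigma> x \<in> dom_of (vsort x))"

definition satisfiable :: "form \<Rightarrow> bool" where
  "satisfiable \<phi> \<longleftrightarrow> (\<exists>\<sigma>. assignment \<sigma> \<and> eval \<sigma> \<phi>)"

definition valid :: "form \<Rightarrow> bool" where
  "valid \<phi> \<longleftrightarrow> (\<forall>\<sigma>. assignment \<sigma> \<longrightarrow> eval \<sigma> \<phi>)"

definition solutions :: "form \<Rightarrow> var list \<Rightarrow> val list set" where
  "solutions \<phi> xs = {map \<sigma> xs | \<sigma>. assignment \<sigma> \<and> eval \<sigma> \<phi>}"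

definition big_conj :: "'v fm list \<Rightarrow> 'v fm" where
  "big_conj \<phi>s = foldr Conj \<phi>s Top"

definition big_disj :: "'v fm list \<Rightarrow> 'v fm" where
  "big_disj \<phi>s = foldr Disj \<phi>s Bot"

text \<open>An arbitrary enumeration of a finite set, to form conjunctions over sets of formulas.\<close>

definition list_of :: "'b set \<Rightarrow> 'b list" where
  "list_of A = (SOME xs. distinct xs \<and> set xs = A)"


section \<open>Constrained Horn clauses\<close>

text \<open>
  A clause is implicitly closed by universal quantifiers; the head \<open>None\<close> stands for falsity.
\<close>

datatype 'q chc =
  CHC (constr: form) (body: "('q \<times> var list) list") (head: "('q \<times> var list) option")

definition atoms :: "'q chc \<Rightarrow> ('q \<times> var list) set" where
  "atoms C = set (body C) \<union> set_option (head C)"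

definition wf_chc :: "thy \<Rightarrow> ('q \<Rightarrow> sort list) \<Rightarrow> 'q chc \<Rightarrow> bool" where
  "wf_chc a ty C \<longleftrightarrow> qf a (constr C) \<and>
     (\<forall>(p, xs) \<in> atoms C. map vsort xs = ty p \<and> set xs \<subseteq> set_fm (constr C))"

definition is_query :: "'q chc \<Rightarrow> bool" where
  "is_query C \<longleftrightarrow> head C = None"

definition body_holds :: "('q \<Rightarrow> val list set) \<Rightarrow> (var \<Rightarrow> val) \<Rightarrow> 'q chc \<Rightarrow> bool" where
  "body_holds P \<sigma> C \<longleftrightarrow> eval \<sigma> (constr C) \<and> (\<forall>(p, xs) \<in> set (body C). map \<sigma> xs \<in> P p)"

definition query_true :: "('q \<Rightarrow> val list set) \<Rightarrow> 'q chc \<Rightarrow> bool" where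
  "query_true P C \<longleftrightarrow> (\<forall>\<sigma>. assignment \<sigma> \<longrightarrow> \<not> body_holds P \<sigma> C)"

definition consequences ::
  "'q chc set \<Rightarrow> ('q \<Rightarrow> val list set) \<Rightarrow> 'q \<Rightarrow> val list set" where
  "consequences \<Psi> P p = {map \<sigma> xs | \<sigma> xs C.
     C \<in> \<Psi> \<and> head C = Some (p, xs) \<and> assignment \<sigma> \<and> body_holds P \<sigma> C}"

primrec chc_sem_upto :: "'q chc set \<Rightarrow> nat \<Rightarrow> 'q \<Rightarrow> val list set" where
  "chc_sem_upto \<Psi> 0 = consequences \<Psi> (\<lambda>_. {})"
| "chc_sem_upto \<Psi> (Suc n) = consequences \<Psi> (chc_sem_upto \<Psi> n)"

definition chc_sem :: "'q chc set \<Rightarrow> 'q \<Rightarrow> val list set" where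
  "chc_sem \<Psi> p = (\<Union>n. chc_sem_upto \<Psi> n p)"

definition chc_satisfiable :: "'q chc set \<Rightarrow> bool" where
  "chc_satisfiable \<Psi> \<longleftrightarrow> (\<forall>C\<in>\<Psi>. is_query C \<longrightarrow> query_true (chc_sem \<Psi>) C)"


section \<open>Transformers\<close>

text \<open>
  The data fixed throughout. The type parameter \<open>'p\<close> is the set of uninterpreted predicate
  symbols; \<open>ypar p\<close> is the fixed tuple of formal parameters of the bit-vector copy of \<open>p\<close>.
  The domain restriction \<open>rho\<close> is applied to integer variables.
\<close>

record 'p setting =
  ptype :: "'p \<Rightarrow> sort list"
  ypar :: "'p \<Rightarrow> var list"
  prime :: "var \<Rightarrow> var"
  delta :: "var \<Rightarrow> bool list \<Rightarrow> int"
  rho :: "var \<Rightarrow> form"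
  tau_BV_IA :: "form \<Rightarrow> form"
  tau_IA_BV :: "form \<Rightarrow> form"

definition vars_of_thy :: "thy \<Rightarrow> var set" where
  "vars_of_thy a = {x. sort_of_thy a (vsort x)}"

definition domain_tuples :: "var list \<Rightarrow> val list set" where
  "domain_tuples xs = {vs. list_all2 (\<lambda>x v. v \<in> dom_of (vsort x)) xs vs}"

definition delta_tuple :: "'p setting \<Rightarrow> var list \<Rightarrow> val list \<Rightarrow> val list" where
  "delta_tuple K xs vs = map2 (\<lambda>x v. IVal (delta K x (bits v))) xs vs"

definition delta_pre :: "'p setting \<Rightarrow> var list \<Rightarrow> val list set \<Rightarrow> val list set" where
  "delta_pre K xs A = {vs \<in> domain_tuples xs. delta_tuple K xs vs \<in> A}"

definition same_domain_transformer :: "'p setting \<Rightarrow> var \<Rightarrow> var \<Rightarrow> bool" where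
  "same_domain_transformer K x y \<longleftrightarrow> vsort x = vsort y \<and>
     (\<forall>bs. BVal bs \<in> dom_of (vsort x) \<longrightarrow> delta K x bs = delta K y bs)"

text \<open>
  Here \<open>xs\<close> enumerates the free variables of the bit-vector formula \<open>\<phi>\<close>, and \<open>\<phi>'\<close> is the integer
  formula over the corresponding primed variables.
\<close>

definition transforms :: "'p setting \<Rightarrow> form \<Rightarrow> form \<Rightarrow> bool" where
  "transforms K \<phi> \<phi>' \<longleftrightarrow> set_fm \<phi>' = prime K ` set_fm \<phi> \<and>
     (\<forall>xs. distinct xs \<and> set xs = set_fm \<phi> \<longrightarrow>
        solutions \<phi> xs =
          delta_pre K xs (solutions \<phi>' (map (prime K) xs) \<inter> delta_tuple K xs ` domain_tuples xs))"

definition wf_setting :: "'p setting \<Rightarrow> bool" where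
  "wf_setting K \<longleftrightarrow>
     (\<forall>p. list_all (sort_of_thy BV) (ptype K p)) \<and>
     (\<forall>p. distinct (ypar K p) \<and> map vsort (ypar K p) = ptype K p) \<and>
     bij_betw (prime K) (vars_of_thy BV) (vars_of_thy IA) \<and>
     (\<forall>x\<in>vars_of_thy BV. inj_on (delta K x) {bs. BVal bs \<in> dom_of (vsort x)}) \<and>
     (\<forall>x\<in>vars_of_thy BV. qf IA (rho K (prime K x)) \<and> set_fm (rho K (prime K x)) = {prime K x} \<and>
        (\<forall>\<sigma>. assignment \<sigma> \<longrightarrow> eval \<sigma> (rho K (prime K x)) =
           (\<exists>bs. BVal bs \<in> dom_of (vsort x) \<and> \<sigma> (prime K x) = IVal (delta K x bs)))) \<and>
     (\<forall>\<phi>. qf BV \<phi> \<longrightarrow> qf IA (tau_BV_IA K \<phi>) \<and> transforms K \<phi> (tau_BV_IA K \<phi>)) \<and>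
     (\<forall>\<phi>'. qf IA \<phi>' \<longrightarrow> qf BV (tau_IA_BV K \<phi>') \<and> transforms K (tau_IA_BV K \<phi>') \<phi>')"

definition wf_chcs :: "'p setting \<Rightarrow> 'p chc set \<Rightarrow> bool" where
  "wf_chcs K \<Phi> \<longleftrightarrow> (\<forall>C\<in>\<Phi>. wf_chc BV (ptype K) C \<and>
     (\<forall>(p, xs) \<in> atoms C. list_all2 (same_domain_transformer K) xs (ypar K p)))"

primrec tau :: "'p setting \<Rightarrow> thy \<Rightarrow> form \<Rightarrow> form" where
  "tau K BV = tau_BV_IA K"
| "tau K IA = tau_IA_BV K"


section \<open>Theory-modular encodings\<close>

text \<open>The copy of \<open>p\<close> in theory \<open>a\<close> is the pair \<open>(a, p)\<close>.\<close>

type_synonym 'p pcopy = "thy \<times> 'p"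

type_synonym 'p encoding =
  "'p pcopy chc set \<times> 'p pcopy chc set \<times> ('p pcopy \<times> 'p pcopy) set"

fun fragment :: "'p encoding \<Rightarrow> thy \<Rightarrow> 'p pcopy chc set" where
  "fragment (\<Phi>\<^sub>B, \<Phi>\<^sub>I, J) BV = \<Phi>\<^sub>B"
| "fragment (\<Phi>\<^sub>B, \<Phi>\<^sub>I, J) IA = \<Phi>\<^sub>I"

fun interface :: "'p encoding \<Rightarrow> ('p pcopy \<times> 'p pcopy) set" where
  "interface (\<Phi>\<^sub>B, \<Phi>\<^sub>I, J) = J"

fun ybar :: "'p setting \<Rightarrow> 'p pcopy \<Rightarrow> var list" where
  "ybar K (BV, p) = ypar K p"
| "ybar K (IA, p) = map (prime K) (ypar K p)"

definition to_BV :: "'p chc \<Rightarrow> 'p pcopy chc" where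
  "to_BV C = map_chc (Pair BV) C"

text \<open>In a well-formed clause all quantified variables occur in the constraint.\<close>

definition non_body_vars :: "'p chc \<Rightarrow> var set" where
  "non_body_vars C = set_fm (constr C) - (\<Union>(p, xs) \<in> set (body C). set xs)"

definition to_IA :: "'p setting \<Rightarrow> 'p chc \<Rightarrow> 'p pcopy chc" where
  "to_IA K C = CHC
     (Conj (tau_BV_IA K (constr C))
        (big_conj (map (\<lambda>x. rho K (prime K x)) (list_of (non_body_vars C)))))
     (map (\<lambda>(p, xs). ((IA, p), map (prime K) xs)) (body C))
     (map_option (\<lambda>(p, xs). ((IA, p), map (prime K) xs)) (head C))"

definition head_preds :: "'q chc set \<Rightarrow> 'q set" where
  "head_preds \<Psi> = {p. \<exists>C\<in>\<Psi>. \<exists>xs. head C = Some (p, xs)}"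

definition body_preds :: "'q chc set \<Rightarrow> 'q set" where
  "body_preds \<Psi> = {p. \<exists>C\<in>\<Psi>. \<exists>xs. (p, xs) \<in> set (body C)}"

definition encoding :: "'p setting \<Rightarrow> 'p chc set \<Rightarrow> 'p chc set \<Rightarrow> 'p encoding" where
  "encoding K \<Phi> \<Delta>\<^sub>B =
    (let \<Phi>\<^sub>B = to_BV ` \<Delta>\<^sub>B; \<Phi>\<^sub>I = to_IA K ` (\<Phi> - \<Delta>\<^sub>B)
     in (\<Phi>\<^sub>B, \<Phi>\<^sub>I,
         {((BV, p), (IA, p)) | p. (BV, p) \<in> head_preds \<Phi>\<^sub>B \<and> (IA, p) \<in> body_preds \<Phi>\<^sub>I} \<union>
         {((IA, p), (BV, p)) | p. (IA, p) \<in> head_preds \<Phi>\<^sub>I \<and> (BV, p) \<in> body_preds \<Phi>\<^sub>B}))"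

text \<open>
  Transport of a relation for \<open>p\<close> into the given theory. The domain transformer of \<open>p\<close> is that
  of its formal parameters, with which every application of \<open>p\<close> agrees.
\<close>

primrec transport :: "'p setting \<Rightarrow> thy \<Rightarrow> 'p \<Rightarrow> val list set \<Rightarrow> val list set" where
  "transport K IA p A = delta_tuple K (ypar K p) ` A"
| "transport K BV p A = delta_pre K (ypar K p) A"

primrec enc_sem_upto :: "'p setting \<Rightarrow> 'p encoding \<Rightarrow> nat \<Rightarrow> 'p pcopy \<Rightarrow> val list set" where
  "enc_sem_upto K E 0 = (\<lambda>(a, p). consequences (fragment E a) (\<lambda>_. {}) (a, p))"
| "enc_sem_upto K E (Suc n) = (\<lambda>(a, p).
     consequences (fragment E a) (enc_sem_upto K E n) (a, p) \<union>
     (if ((other a, p), (a, p)) \<in> interface E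
      then transport K a p (enc_sem_upto K E n (other a, p)) else {}))"

definition enc_sem :: "'p setting \<Rightarrow> 'p encoding \<Rightarrow> 'p pcopy \<Rightarrow> val list set" where
  "enc_sem K E p = (\<Union>n. enc_sem_upto K E n p)"

definition enc_satisfiable :: "'p setting \<Rightarrow> 'p encoding \<Rightarrow> bool" where
  "enc_satisfiable K E \<longleftrightarrow>
     (\<forall>a. \<forall>C\<in>fragment E a. is_query C \<longrightarrow> query_true (enc_sem K E) C)"

fun add_BV_query :: "'p pcopy chc \<Rightarrow> 'p encoding \<Rightarrow> 'p encoding" where
  "add_BV_query C (\<Phi>\<^sub>B, \<Phi>\<^sub>I, J) = (\<Phi>\<^sub>B \<union> {C}, \<Phi>\<^sub>I, J)"


section \<open>Solutions and refutations\<close>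

definition interpretation_over :: "'p setting \<Rightarrow> thy \<Rightarrow> ('p pcopy \<Rightarrow> form) \<Rightarrow> bool" where
  "interpretation_over K a J \<longleftrightarrow>
     (\<forall>p. qf a (J (a, p)) \<and> set_fm (J (a, p)) \<subseteq> set (ybar K (a, p)))"

definition renaming :: "'v list \<Rightarrow> 'v list \<Rightarrow> 'v \<Rightarrow> 'v" where
  "renaming ys xs y = (case map_of (zip ys xs) y of Some x \<Rightarrow> x | None \<Rightarrow> y)"

definition inst_atom :: "'p setting \<Rightarrow> ('p pcopy \<Rightarrow> form) \<Rightarrow> 'p pcopy \<times> var list \<Rightarrow> form" where
  "inst_atom K J = (\<lambda>(p, xs). map_fm (renaming (ybar K p) xs) (J p))"

definition inst_chc :: "'p setting \<Rightarrow> ('p pcopy \<Rightarrow> form) \<Rightarrow> 'p pcopy chc \<Rightarrow> form" where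
  "inst_chc K J C = Imp
     (Conj (constr C) (big_conj (map (inst_atom K J) (body C))))
     (case head C of None \<Rightarrow> Bot | Some A \<Rightarrow> inst_atom K J A)"

definition solves ::
  "'p setting \<Rightarrow> thy \<Rightarrow> ('p pcopy \<Rightarrow> form) \<Rightarrow> 'p pcopy chc set \<Rightarrow> bool" where
  "solves K a J \<Psi> \<longleftrightarrow> interpretation_over K a J \<and> (\<forall>C\<in>\<Psi>. valid (inst_chc K J C))"

text \<open>In a derivation tree the label \<open>None\<close> stands for falsity.\<close>

datatype 'q dtree = Node (label: "('q \<times> form) option") (children: "'q dtree list")

primrec nodes :: "'q dtree \<Rightarrow> 'q dtree set" where
  "nodes (Node l ts) = insert (Node l ts) (\<Union>(set (map nodes ts)))"

definition proper_nodes :: "'q dtree \<Rightarrow> 'q dtree set" where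
  "proper_nodes \<pi> = \<Union>(nodes ` set (children \<pi>))"

definition is_leaf :: "'q dtree \<Rightarrow> bool" where
  "is_leaf t \<longleftrightarrow> children t = []"

definition wf_node :: "'p setting \<Rightarrow> thy \<Rightarrow> 'p pcopy chc set \<Rightarrow> 'p pcopy dtree \<Rightarrow> bool" where
  "wf_node K a \<Psi> t \<longleftrightarrow> (\<exists>r \<psi>. label t = Some ((a, r), \<psi>) \<and>
     qf a \<psi> \<and> set_fm \<psi> \<subseteq> set (ybar K (a, r)) \<and> satisfiable \<psi> \<and>
     solutions \<psi> (ybar K (a, r)) \<subseteq> chc_sem \<Psi> (a, r) \<and>
     (is_leaf t \<longrightarrow> solutions \<psi> (ybar K (a, r)) \<subseteq> consequences \<Psi> (\<lambda>_. {}) (a, r)))"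

text \<open>
  A refutation of \<open>\<Psi>\<close>, whose only query is the one of the obligation \<open>(p, \<phi>)\<close>. Interpreting
  all predicates in rule bodies as empty leaves exactly the consequences of the facts, which
  are what leaves are labelled with.
\<close>

definition refutation ::
  "'p setting \<Rightarrow> thy \<Rightarrow> 'p pcopy chc set \<Rightarrow> 'p pcopy \<times> form \<Rightarrow> 'p pcopy dtree \<Rightarrow> bool" where
  "refutation K a \<Psi> = (\<lambda>(p, \<phi>) \<pi>.
     \<not> chc_satisfiable \<Psi> \<and>
     label \<pi> = None \<and>
     (\<forall>t\<in>proper_nodes \<pi>. wf_node K a \<Psi> t) \<and>
     (\<exists>t \<psi>. children \<pi> = [t] \<and> label t = Some (p, \<psi>) \<and> satisfiable (Conj \<psi> \<phi>)))"


section \<open>The procedure Solve\<close>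

type_synonym 'p lemmas_set = "('p pcopy \<times> form) set"

type_synonym 'p state = "'p lemmas_set \<times> 'p lemmas_set \<times> 'p lemmas_set"

primrec domain_restr :: "'p setting \<Rightarrow> thy \<Rightarrow> var list \<Rightarrow> form" where
  "domain_restr K BV ys = Top"
| "domain_restr K IA ys = big_conj (map (rho K) ys)"

definition lemmas_for :: "'p lemmas_set \<Rightarrow> 'p pcopy \<Rightarrow> form list" where
  "lemmas_for L s = list_of {\<psi>. (s, \<psi>) \<in> L}"

definition with_over :: "'p setting \<Rightarrow> 'p encoding \<Rightarrow> thy \<Rightarrow> 'p lemmas_set \<Rightarrow> 'p pcopy chc set" where
  "with_over K E a O\<^sub>L = fragment E a \<union>
     {CHC (Conj (big_conj (lemmas_for O\<^sub>L (a, s))) (domain_restr K a (ybar K (a, s))))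
          [] (Some ((a, s), ybar K (a, s))) | s. ((other a, s), (a, s)) \<in> interface E}"

definition with_under :: "'p setting \<Rightarrow> 'p encoding \<Rightarrow> thy \<Rightarrow> 'p lemmas_set \<Rightarrow> 'p pcopy chc set" where
  "with_under K E a U = fragment E a \<union>
     {CHC (Conj (big_disj (lemmas_for U (a, s))) (domain_restr K a (ybar K (a, s))))
          [] (Some ((a, s), ybar K (a, s))) | s. ((other a, s), (a, s)) \<in> interface E}"

definition query_for :: "'p setting \<Rightarrow> 'p pcopy \<times> form \<Rightarrow> 'p pcopy chc set" where
  "query_for K = (\<lambda>((a, p), \<phi>).
     {CHC (Conj \<phi> (domain_restr K a (ybar K (a, p)))) [((a, p), ybar K (a, p))] None})"

text \<open>The parameter \<open>g\<close> is the initial obligation.\<close>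

inductive solve_step ::
  "'p setting \<Rightarrow> 'p encoding \<Rightarrow> 'p pcopy \<times> form \<Rightarrow> 'p state \<Rightarrow> 'p state \<Rightarrow> bool"
  for K E g where
  NegAnswer:
    "((a, p), \<phi>) \<in> Q - {g} \<Longrightarrow>
     solves K a J (with_over K E a O\<^sub>L \<union> query_for K ((a, p), \<phi>)) \<Longrightarrow>
     solve_step K E g (Q, U, O\<^sub>L)
       (Q - {((a, p), \<phi>)}, U, O\<^sub>L \<union> {((other a, p), tau K a (J (a, p)))})"
| PosAnswer:
    "((a, p), \<phi>) \<in> Q - {g} \<Longrightarrow>
     refutation K a (with_under K E a U \<union> query_for K ((a, p), \<phi>)) ((a, p), \<phi>) \<pi> \<Longrightarrow>
     t \<in> set (children \<pi>) \<Longrightarrow> label t = Some ((a, p), \<psi>) \<Longrightarrow>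
     solve_step K E g (Q, U, O\<^sub>L)
       (Q - {((a, p), \<phi>)}, U \<union> {((other a, p), tau K a \<psi>)}, O\<^sub>L)"
| Query:
    "((a, p), \<phi>) \<in> Q \<Longrightarrow>
     solves K a J (with_under K E a U \<union> query_for K ((a, p), \<phi>)) \<Longrightarrow>
     refutation K a (with_over K E a O\<^sub>L \<union> query_for K ((a, p), \<phi>)) ((a, p), \<phi>) \<pi> \<Longrightarrow>
     t \<in> proper_nodes \<pi> \<Longrightarrow> is_leaf t \<Longrightarrow> label t = Some ((a, r), \<psi>) \<Longrightarrow>
     ((other a, r), (a, r)) \<in> interface E \<Longrightarrow>
     solve_step K E g (Q, U, O\<^sub>L) (Q \<union> {((other a, r), tau K a \<psi>)}, U, O\<^sub>L)"

datatype answer = SAT | UNSAT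

inductive state_returns ::
  "'p setting \<Rightarrow> 'p encoding \<Rightarrow> 'p pcopy \<times> form \<Rightarrow> 'p state \<Rightarrow> answer \<Rightarrow> bool"
  for K E g where
  Sat:
    "solves K BV J (with_over K E BV O\<^sub>L \<union> query_for K g) \<Longrightarrow>
     state_returns K E g ({g}, U, O\<^sub>L) SAT"
| Unsat:
    "refutation K BV (with_under K E BV U \<union> query_for K g) g \<pi> \<Longrightarrow>
     state_returns K E g ({g}, U, O\<^sub>L) UNSAT"

definition solve_returns ::
  "'p setting \<Rightarrow> 'p encoding \<Rightarrow> 'p pcopy \<times> form \<Rightarrow> answer \<Rightarrow> bool" where
  "solve_returns K E g r \<longleftrightarrow>
     (\<exists>s. (solve_step K E g)\<^sup>*\<^sup>* ({g}, {}, {}) s \<and> state_returns K E g s r)"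

end

theory Submission
  imports Defs
begin

text \<open>
  Soundness is an invariant of the lemma sets. A lemma \<open>\<psi>\<close> for \<open>p\<close> in theory \<open>a\<close> speaks about the
  external part of the semantics of \<open>p\<close>, that is, the transported semantics of its copy in the other
  theory: the lemmas in \<open>O\<close> contain it, those in \<open>U\<close>, cut down to the image of the domain
  transformers, are contained in it. Hence every solution of the over-approximating clauses contains
  the semantics of the encoding, and the semantics of the under-approximating clauses is
  contained in it; theory transformers commute with transport, so that new lemmas keep the
  invariant.
\<close>

section \<open>Formulas and their solutions\<close>

lemma eval_trm_map_trm: "eval_trm \<sigma> (map_trm f t) = eval_trm (\<sigma> \<circ> f) t"
  by (induction t) (simp_all cong: map_cong)

lemma eval_map_fm: "eval \<sigma> (map_fm f \<phi>) = eval (\<sigma> \<circ> f) \<phi>"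
  by (induction \<phi>) (simp_all add: eval_trm_map_trm comp_def cong: map_cong)

lemma eval_trm_cong: "(\<And>x. x \<in> set_trm t \<Longrightarrow> \<sigma> x = \<sigma>' x) \<Longrightarrow> eval_trm \<sigma> t = eval_trm \<sigma>' t"
proof (induction t)
  case (Fn f ts)
  then have "map (eval_trm \<sigma>) ts = map (eval_trm \<sigma>') ts"
    by (intro map_cong) auto
  then show ?case
    by (simp only: eval_trm.simps)
qed simp

lemma eval_cong: "(\<And>x. x \<in> set_fm \<phi> \<Longrightarrow> \<sigma> x = \<sigma>' x) \<Longrightarrow> eval \<sigma> \<phi> = eval \<sigma>' \<phi>"
proof (induction \<phi>)
  case (Atom p ts)
  then have "map (eval_trm \<sigma>) ts = map (eval_trm \<sigma>') ts"
    by (intro map_cong eval_trm_cong) auto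
  then show ?case
    by (simp only: eval.simps)
qed simp_all

lemma finite_set_trm: "finite (set_trm t)"
  by (induction t) simp_all

lemma finite_set_fm: "finite (set_fm \<phi>)"
  by (induction \<phi>) (simp_all add: finite_set_trm)

lemma wf_trm_vars: "wf_trm a t \<Longrightarrow> set_trm t \<subseteq> vars_of_thy a"
  by (induction t) (auto simp: vars_of_thy_def list_all_iff)

lemma qf_vars: "qf a \<phi> \<Longrightarrow> set_fm \<phi> \<subseteq> vars_of_thy a"
proof (induction \<phi>)
  case (Atom p ts)
  then show ?case
    using wf_trm_vars by (fastforce simp: list_all_iff)
qed auto

lemma eval_big_conj: "eval \<sigma> (big_conj \<phi>s) \<longleftrightarrow> (\<forall>\<phi>\<in>set \<phi>s. eval \<sigma> \<phi>)"
  unfolding big_conj_def by (induction \<phi>s) auto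

lemma eval_big_disj: "eval \<sigma> (big_disj \<phi>s) \<longleftrightarrow> (\<exists>\<phi>\<in>set \<phi>s. eval \<sigma> \<phi>)"
  unfolding big_disj_def by (induction \<phi>s) auto

lemma set_list_of: "finite A \<Longrightarrow> set (list_of A) = A"
  unfolding list_of_def by (rule someI2_ex) (use finite_distinct_list in blast)+

lemma set_lemmas_for:
  assumes "finite L"
  shows "set (lemmas_for L s) = {\<psi>. (s, \<psi>) \<in> L}"
proof -
  have "finite {\<psi>. (s, \<psi>) \<in> L}"
    by (rule finite_subset[of _ "snd ` L"]) (use assms in force)+
  then show ?thesis
    by (simp add: lemmas_for_def set_list_of)
qed

text \<open>Solution sets are given by existentially chosen assignments. Since the free variables of
  \<open>\<phi>\<close> lie in \<open>xs\<close>, its truth value depends only on the tuple, so any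
  assignment with these values decides membership.\<close>

lemma map_in_solutions_iff:
  assumes "assignment \<sigma>" and "set_fm \<phi> \<subseteq> set xs"
  shows "map \<sigma> xs \<in> solutions \<phi> xs \<longleftrightarrow> eval \<sigma> \<phi>"
proof
  assume "map \<sigma> xs \<in> solutions \<phi> xs"
  then obtain \<sigma>' where "map \<sigma> xs = map \<sigma>' xs" and "eval \<sigma>' \<phi>"
    by (auto simp: solutions_def)
  then show "eval \<sigma> \<phi>"
    using eval_cong[of \<phi> \<sigma> \<sigma>'] assms(2) by auto
qed (use assms(1) in \<open>auto simp: solutions_def\<close>)

section \<open>Value tuples and well-sorted assignments\<close>

lemma dom_of_nonempty: "\<exists>v. v \<in> dom_of s"
proof (cases s)
  case (BVSort n)
  then show ?thesis
    by (auto intro: exI[of _ "replicate n False"])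
qed auto

lemma domain_tuples_eq:
  assumes "distinct xs"
  shows "domain_tuples xs = {map \<sigma> xs | \<sigma>. assignment \<sigma>}"
proof (intro set_eqI iffI)
  fix vs assume "vs \<in> domain_tuples xs"
  then have vs: "list_all2 (\<lambda>x v. v \<in> dom_of (vsort x)) xs vs"
    by (simp add: domain_tuples_def)
  \<comment> \<open>Assignments are total, so variables outside \<open>xs\<close> receive an
    arbitrary value of their sort.\<close>
  define \<sigma> where "\<sigma> x = (case map_of (zip xs vs) x of Some v \<Rightarrow> v
    | None \<Rightarrow> SOME v. v \<in> dom_of (vsort x))" for x
  have "\<sigma> (xs ! i) = vs ! i" if "i < length xs" for i
    using that vs assms by (simp add: \<sigma>_def map_of_zip_nth list_all2_lengthD)
  then have "map \<sigma> xs = vs"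
    using vs by (simp add: list_eq_iff_nth_eq list_all2_lengthD)
  moreover have "\<sigma> x \<in> dom_of (vsort x)" for x
  proof (cases "map_of (zip xs vs) x")
    case None
    then show ?thesis
      by (simp add: \<sigma>_def someI_ex[OF dom_of_nonempty])
  next
    case (Some v)
    then have "(x, v) \<in> set (zip xs vs)"
      by (rule map_of_SomeD)
    then show ?thesis
      using vs Some by (auto simp: \<sigma>_def list_all2_iff)
  qed
  ultimately show "vs \<in> {map \<sigma> xs | \<sigma>. assignment \<sigma>}"
    unfolding assignment_def by blast
next
  fix vs assume "vs \<in> {map \<sigma> xs | \<sigma>. assignment \<sigma>}"
  then show "vs \<in> domain_tuples xs"
    by (auto simp: domain_tuples_def assignment_def list_all2_conv_all_nth)
qed

lemma map_in_domain_tuples: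
  "assignment \<sigma> \<Longrightarrow> map vsort xs = map vsort ys \<Longrightarrow> map \<sigma> xs \<in> domain_tuples ys"
  unfolding domain_tuples_def assignment_def list_all2_conv_all_nth mem_Collect_eq
  by (metis length_map nth_map)

lemma delta_tuple_map: "delta_tuple K xs (map \<sigma> xs) = map (\<lambda>x. IVal (delta K x (bits (\<sigma> x)))) xs"
  unfolding delta_tuple_def by (induction xs) auto

section \<open>Renaming formal parameters to actual arguments\<close>

lemma renaming_nth:
  assumes "distinct ys" and "length xs = length ys" and "i < length ys"
  shows "renaming ys xs (ys ! i) = xs ! i"
  using assms by (simp add: renaming_def map_of_zip_nth)

lemma vsort_renaming:
  assumes "distinct ys" and "map vsort xs = map vsort ys"
  shows "vsort (renaming ys xs y) = vsort y"
proof (cases "y \<in> set ys")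
  case True
  then obtain i where i: "i < length ys" "y = ys ! i"
    by (auto simp: in_set_conv_nth)
  have len: "length xs = length ys"
    using assms(2) map_eq_imp_length_eq by blast
  have "vsort (xs ! i) = vsort (ys ! i)"
    using assms(2) i len by (metis nth_map)
  then show ?thesis
    using i assms(1) len by (simp add: renaming_nth)
next
  case False
  then have "map_of (zip ys xs) y = None"
    by (auto simp: map_of_eq_None_iff dest: set_zip_leftD)
  then show ?thesis
    by (simp add: renaming_def)
qed

text \<open>Evaluating after a substitution is evaluating under the composed assignment
  \<open>\<sigma> \<circ> renaming (ybar K s) xs\<close>. It is well-sorted because the renaming
  preserves sorts, and its values on the formal parameters are those of \<open>\<sigma>\<close> on
  the actual arguments.\<close>

lemma eval_inst_atom:
  assumes "distinct (ybar K s)" and sorts: "map vsort xs = map vsort (ybar K s)"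
    and "assignment \<sigma>" and "set_fm (J s) \<subseteq> set (ybar K s)"
  shows "eval \<sigma> (inst_atom K J (s, xs)) \<longleftrightarrow> map \<sigma> xs \<in> solutions (J s) (ybar K s)"
proof -
  let ?\<sigma> = "\<sigma> \<circ> renaming (ybar K s) xs"
  have "length xs = length (ybar K s)"
    using sorts map_eq_imp_length_eq by blast
  then have "map ?\<sigma> (ybar K s) = map \<sigma> xs"
    using assms(1) by (simp add: list_eq_iff_nth_eq renaming_nth)
  moreover have "assignment ?\<sigma>"
    using assms by (metis assignment_def comp_apply vsort_renaming)
  ultimately show ?thesis
    using map_in_solutions_iff[of ?\<sigma> "J s" "ybar K s"] assms(4)
    by (simp add: inst_atom_def eval_map_fm)
qed

section \<open>Transport along the domain transformers\<close>

lemma other_other [simp]: "other (other a) = a"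
  by (cases a) auto

lemma transport_mono: "A \<subseteq> B \<Longrightarrow> transport K a p A \<subseteq> transport K a p B"
  by (cases a) (auto simp: delta_pre_def)

lemma transport_UN: "transport K a p (\<Union>n. A n) = (\<Union>n. transport K a p (A n))"
  by (cases a) (auto simp: delta_pre_def)

text \<open>Pointwise form of the defining equation of theory transformers, which is stated for
  solution sets over an enumeration of the free variables. It is the form used for assignments of
  the two theories that are linked by \<open>delta\<close>.\<close>

lemma transforms_eval:
  assumes "transforms K \<phi> \<phi>'" and "assignment \<sigma>" and "assignment \<sigma>'"
    and \<sigma>': "\<And>x. x \<in> set_fm \<phi> \<Longrightarrow> \<sigma>' (prime K x) = IVal (delta K x (bits (\<sigma> x)))"
  shows "eval \<sigma> \<phi> \<longleftrightarrow> eval \<sigma>' \<phi>'"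
proof -
  obtain xs where xs: "distinct xs" "set xs = set_fm \<phi>"
    using finite_distinct_list[OF finite_set_fm, of \<phi>] by blast
  have vars: "set_fm \<phi>' = set (map (prime K) xs)"
    and sol: "solutions \<phi> xs = delta_pre K xs
      (solutions \<phi>' (map (prime K) xs) \<inter> delta_tuple K xs ` domain_tuples xs)"
    using assms(1) xs by (simp_all add: transforms_def)
  have delta: "delta_tuple K xs (map \<sigma> xs) = map \<sigma>' (map (prime K) xs)"
    using \<sigma>' xs by (simp add: delta_tuple_map)
  have dom: "map \<sigma> xs \<in> domain_tuples xs"
    using assms(2) by (intro map_in_domain_tuples) simp_all
  have "eval \<sigma> \<phi> \<longleftrightarrow> map \<sigma> xs \<in> solutions \<phi> xs"
    using assms(2) xs by (simp add: map_in_solutions_iff)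
  \<comment> \<open>The intersection with the image of \<open>delta_tuple\<close> is harmless here:
    the tuple in question is the image of the domain tuple \<open>map \<sigma> xs\<close>.\<close>
  also have "\<dots> \<longleftrightarrow> delta_tuple K xs (map \<sigma> xs) \<in> solutions \<phi>' (map (prime K) xs)"
    unfolding sol delta_pre_def using dom by blast
  also have "\<dots> \<longleftrightarrow> eval \<sigma>' \<phi>'"
    unfolding delta by (rule map_in_solutions_iff) (use assms(3) vars in auto)
  finally show ?thesis .
qed

section \<open>Well-formed settings: linked assignments and transformed formulas\<close>

context
  fixes K :: "'p setting"
  assumes wf: "wf_setting K"
begin

lemma bij_prime: "bij_betw (prime K) (vars_of_thy BV) (vars_of_thy IA)"
  using wf by (simp add: wf_setting_def)

lemma ypar_vars: "set (ypar K p) \<subseteq> vars_of_thy BV"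
proof -
  have "list_all (sort_of_thy BV) (map vsort (ypar K p))"
    using wf by (simp add: wf_setting_def)
  then show ?thesis
    by (auto simp: list_all_iff vars_of_thy_def)
qed

lemma distinct_ybar: "distinct (ybar K s)"
proof -
  obtain a p where s: "s = (a, p)"
    by fastforce
  have "distinct (ypar K p)"
    using wf by (simp add: wf_setting_def)
  moreover have "inj_on (prime K) (set (ypar K p))"
    using bij_prime ypar_vars by (meson bij_betw_imp_inj_on inj_on_subset)
  ultimately show ?thesis
    by (cases a) (simp_all add: s distinct_map)
qed

lemma vsort_prime: "x \<in> vars_of_thy BV \<Longrightarrow> vsort (prime K x) = IntSort"
  using bij_betwE[OF bij_prime] by (cases "vsort (prime K x)") (auto simp: vars_of_thy_def)

text \<open>As \<open>prime\<close> is a bijection between the variables of the two theories, all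
  integer variables can be set at once: each takes the transformed value of the bit-vector variable
  that it copies.\<close>

lemma exists_int_assignment:
  assumes "assignment \<sigma>"
  obtains \<sigma>' where "assignment \<sigma>'"
    and "\<And>x. x \<in> vars_of_thy BV \<Longrightarrow> \<sigma>' (prime K x) = IVal (delta K x (bits (\<sigma> x)))"
proof
  let ?inv = "inv_into (vars_of_thy BV) (prime K)"
  let ?\<sigma>' = "\<lambda>y. if vsort y = IntSort then IVal (delta K (?inv y) (bits (\<sigma> (?inv y)))) else \<sigma> y"
  show "assignment ?\<sigma>'"
    using assms by (auto simp: assignment_def)
  show "?\<sigma>' (prime K x) = IVal (delta K x (bits (\<sigma> x)))" if "x \<in> vars_of_thy BV" for x
    using that bij_betw_inv_into_left[OF bij_prime that] by (simp add: vsort_prime)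
qed

lemma eval_domain_restr_IA:
  assumes "assignment \<sigma>"
  shows "eval \<sigma> (domain_restr K IA (ybar K (IA, p))) \<longleftrightarrow>
    (\<forall>x\<in>set (ypar K p). \<exists>v\<in>dom_of (vsort x). \<sigma> (prime K x) = IVal (delta K x (bits v)))"
proof -
  have "eval \<sigma> (rho K (prime K x)) \<longleftrightarrow>
      (\<exists>v\<in>dom_of (vsort x). \<sigma> (prime K x) = IVal (delta K x (bits v)))"
    if "x \<in> set (ypar K p)" for x
  proof -
    have x: "x \<in> vars_of_thy BV"
      using that ypar_vars by blast
    \<comment> \<open>In a bit-vector sort every value is of the form \<open>BVal bs\<close>, so
      quantifying over values or over bit lists is the same.\<close>
    then obtain n where "vsort x = BVSort n"
      by (cases "vsort x") (auto simp: vars_of_thy_def)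
    moreover have "eval \<sigma> (rho K (prime K x)) =
        (\<exists>bs. BVal bs \<in> dom_of (vsort x) \<and> \<sigma> (prime K x) = IVal (delta K x bs))"
      using x assms wf unfolding wf_setting_def by blast
    ultimately show ?thesis
      by auto
  qed
  then show ?thesis
    by (simp add: eval_big_conj)
qed

text \<open>Partial converse of \<open>exists_int_assignment\<close>: an integer value has a
  preimage only where the domain restriction guarantees one, so the link is obtained for the
  parameters of \<open>p\<close> alone.\<close>

lemma exists_BV_assignment:
  assumes "assignment \<sigma>'" and "eval \<sigma>' (domain_restr K IA (ybar K (IA, p)))"
  obtains \<sigma> where "assignment \<sigma>"
    and "\<And>x. x \<in> set (ypar K p) \<Longrightarrow> \<sigma>' (prime K x) = IVal (delta K x (bits (\<sigma> x)))"
proof -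
  \<comment> \<open>With the membership condition inside the existential, a witness exists for every
    variable, and choice yields a total assignment.\<close>
  have "\<exists>v\<in>dom_of (vsort x). x \<in> set (ypar K p) \<longrightarrow>
      \<sigma>' (prime K x) = IVal (delta K x (bits v))" for x
    using assms dom_of_nonempty[of "vsort x"] unfolding eval_domain_restr_IA[OF assms(1)] by blast
  then show thesis
    unfolding Bex_def using that assignment_def by metis
qed

lemma set_fm_tau:
  assumes "qf a \<psi>" and sub: "set_fm \<psi> \<subseteq> set (ybar K (a, p))"
  shows "set_fm (tau K a \<psi>) \<subseteq> set (ybar K (other a, p))"
proof (cases a)
  case BV
  then have "transforms K \<psi> (tau K a \<psi>)"
    using assms(1) wf by (simp add: wf_setting_def)
  then show ?thesis
    using BV sub by (auto simp: transforms_def)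
next
  case IA
  then have tr: "transforms K (tau K a \<psi>) \<psi>" and "qf BV (tau K a \<psi>)"
    using assms(1) wf by (simp_all add: wf_setting_def)
  then have "set_fm (tau K a \<psi>) \<subseteq> vars_of_thy BV"
    using qf_vars by blast
  \<comment> \<open>The transformer only controls the primed variables; injectivity of
    \<open>prime\<close> on bit-vector variables then cancels the primes.\<close>
  moreover have "prime K ` set_fm (tau K a \<psi>) \<subseteq> prime K ` set (ypar K p)"
    using tr sub IA by (simp add: transforms_def)
  ultimately show ?thesis
    using IA inj_on_image_mem_iff[OF bij_betw_imp_inj_on[OF bij_prime] _ ypar_vars[of p]]
    by (auto simp: image_subset_iff)
qed

text \<open>Theory transformers commute with transport. Towards integers, the transformed formula is
  determined only on the image of \<open>delta\<close>, and the domain restriction removes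
  everything else. Towards bit-vectors, every tuple has an integer image and the restriction is
  \<open>Top\<close>.\<close>

lemma solutions_tau:
  assumes qf: "qf a \<psi>" and sub: "set_fm \<psi> \<subseteq> set (ybar K (a, p))"
  shows "solutions (Conj (tau K a \<psi>) (domain_restr K (other a) (ybar K (other a, p))))
      (ybar K (other a, p)) = transport K (other a) p (solutions \<psi> (ybar K (a, p)))"
proof (cases a)
  case BV
  let ?ys = "ypar K p"
  let ?R = "domain_restr K IA (ybar K (IA, p))"
  have tr: "transforms K \<psi> (tau_BV_IA K \<psi>)" and sub: "set_fm \<psi> \<subseteq> set ?ys"
    using qf sub wf BV by (simp_all add: wf_setting_def)
  have "solutions (Conj (tau_BV_IA K \<psi>) ?R) (map (prime K) ?ys)
      = delta_tuple K ?ys ` solutions \<psi> ?ys"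
  proof (intro equalityI subsetI)
    fix vs assume "vs \<in> solutions (Conj (tau_BV_IA K \<psi>) ?R) (map (prime K) ?ys)"
    then obtain \<sigma>' where \<sigma>': "assignment \<sigma>'" "eval \<sigma>' (tau_BV_IA K \<psi>)" "eval \<sigma>' ?R"
      and vs: "vs = map \<sigma>' (map (prime K) ?ys)"
      by (auto simp: solutions_def)
    obtain \<sigma> where \<sigma>: "assignment \<sigma>"
      and eq: "\<And>x. x \<in> set ?ys \<Longrightarrow> \<sigma>' (prime K x) = IVal (delta K x (bits (\<sigma> x)))"
      using exists_BV_assignment \<sigma>'(1,3) by metis
    have "eval \<sigma> \<psi>"
      using transforms_eval[OF tr \<sigma> \<sigma>'(1)] eq sub \<sigma>'(2) by blast
    moreover have "vs = delta_tuple K ?ys (map \<sigma> ?ys)"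
      using eq by (simp add: vs delta_tuple_map)
    ultimately show "vs \<in> delta_tuple K ?ys ` solutions \<psi> ?ys"
      using \<sigma> by (auto simp: solutions_def)
  next
    fix vs assume "vs \<in> delta_tuple K ?ys ` solutions \<psi> ?ys"
    then obtain \<sigma> where \<sigma>: "assignment \<sigma>" "eval \<sigma> \<psi>" and vs: "vs = delta_tuple K ?ys (map \<sigma> ?ys)"
      by (auto simp: solutions_def)
    obtain \<sigma>' where \<sigma>': "assignment \<sigma>'"
      and eq: "\<And>x. x \<in> vars_of_thy BV \<Longrightarrow> \<sigma>' (prime K x) = IVal (delta K x (bits (\<sigma> x)))"
      using exists_int_assignment \<sigma>(1) by metis
    then have eq: "\<sigma>' (prime K x) = IVal (delta K x (bits (\<sigma> x)))" if "x \<in> set ?ys" for x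
      using that ypar_vars by blast
    have "eval \<sigma>' (tau_BV_IA K \<psi>)"
      using transforms_eval[OF tr \<sigma>(1) \<sigma>'] eq sub \<sigma>(2) by blast
    moreover have "eval \<sigma>' ?R"
      using eq \<sigma>(1) unfolding eval_domain_restr_IA[OF \<sigma>'] assignment_def by blast
    moreover have "vs = map \<sigma>' (map (prime K) ?ys)"
      using eq by (simp add: vs delta_tuple_map)
    ultimately show "vs \<in> solutions (Conj (tau_BV_IA K \<psi>) ?R) (map (prime K) ?ys)"
      unfolding solutions_def using \<sigma>' by auto
  qed
  then show ?thesis
    using BV by simp
next
  case IA
  let ?ys = "ypar K p"
  have tr: "transforms K (tau_IA_BV K \<psi>) \<psi>" and sub: "set_fm \<psi> \<subseteq> set (map (prime K) ?ys)"
    using qf sub wf IA by (simp_all add: wf_setting_def)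
  have sub': "set_fm (tau_IA_BV K \<psi>) \<subseteq> set ?ys"
    using set_fm_tau[OF assms] IA by simp
  have iff: "map \<sigma> ?ys \<in> solutions (tau_IA_BV K \<psi>) ?ys \<longleftrightarrow>
      delta_tuple K ?ys (map \<sigma> ?ys) \<in> solutions \<psi> (map (prime K) ?ys)"
    if \<sigma>: "assignment \<sigma>" for \<sigma>
  proof -
    obtain \<sigma>' where \<sigma>': "assignment \<sigma>'"
      and eq: "\<And>x. x \<in> vars_of_thy BV \<Longrightarrow> \<sigma>' (prime K x) = IVal (delta K x (bits (\<sigma> x)))"
      using exists_int_assignment \<sigma> by metis
    then have eq: "\<sigma>' (prime K x) = IVal (delta K x (bits (\<sigma> x)))" if "x \<in> set ?ys" for x
      using that ypar_vars by blast
    have delta: "delta_tuple K ?ys (map \<sigma> ?ys) = map \<sigma>' (map (prime K) ?ys)"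
      using eq by (simp add: delta_tuple_map)
    have "eval \<sigma> (tau_IA_BV K \<psi>) \<longleftrightarrow> eval \<sigma>' \<psi>"
      using transforms_eval[OF tr \<sigma> \<sigma>'] eq sub' by blast
    then show ?thesis
      unfolding delta map_in_solutions_iff[OF \<sigma> sub'] map_in_solutions_iff[OF \<sigma>' sub] .
  qed
  have dom: "domain_tuples ?ys = {map \<sigma> ?ys | \<sigma>. assignment \<sigma>}"
    using domain_tuples_eq distinct_ybar[of "(BV, p)"] by simp
  \<comment> \<open>Both sides of the goal consist of domain tuples, each of which is the value of
    some assignment, so \<open>iff\<close> decides all memberships.\<close>
  have "solutions (tau_IA_BV K \<psi>) ?ys \<subseteq> domain_tuples ?ys"
    unfolding dom by (auto simp: solutions_def)
  then have "solutions (tau_IA_BV K \<psi>) ?ys = delta_pre K ?ys (solutions \<psi> (map (prime K) ?ys))"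
    using iff unfolding delta_pre_def dom by blast
  then show ?thesis
    using IA by (simp add: solutions_def)
qed

text \<open>Makes the clauses added for interface predicates applicable to transported tuples, whose
  constraint includes the domain restriction. \<open>delta_tuple\<close> reads the bits of any
  tuple, so for \<open>IA\<close> the source must be known to consist of domain tuples; for
  \<open>BV\<close>, \<open>delta_pre\<close> already selects them.\<close>

lemma eval_domain_restr_transport:
  assumes "\<And>xs. xs \<in> A \<Longrightarrow> a = IA \<Longrightarrow> xs \<in> domain_tuples (ypar K p)"
    and vs: "vs \<in> transport K a p A"
  obtains \<sigma> where "assignment \<sigma>" and "vs = map \<sigma> (ybar K (a, p))"
    and "eval \<sigma> (domain_restr K a (ybar K (a, p)))"
proof -
  have dom: "domain_tuples (ypar K p) = {map \<sigma> (ypar K p) | \<sigma>. assignment \<sigma>}"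
    using domain_tuples_eq distinct_ybar[of "(BV, p)"] by simp
  show thesis
  proof (cases a)
    case BV
    then show ?thesis
      using vs that by (auto simp: delta_pre_def dom)
  next
    case IA
    then obtain us where "us \<in> A" and "vs = delta_tuple K (ypar K p) us"
      using vs by auto
    moreover from this assms(1) IA have "us \<in> domain_tuples (ypar K p)"
      by blast
    ultimately obtain \<sigma> where \<sigma>: "assignment \<sigma>"
      and us: "vs = delta_tuple K (ypar K p) (map \<sigma> (ypar K p))"
      by (auto simp: dom)
    obtain \<sigma>' where \<sigma>': "assignment \<sigma>'"
      and eq: "\<And>x. x \<in> vars_of_thy BV \<Longrightarrow> \<sigma>' (prime K x) = IVal (delta K x (bits (\<sigma> x)))"
      using exists_int_assignment \<sigma> by metis
    then have eq: "\<sigma>' (prime K x) = IVal (delta K x (bits (\<sigma> x)))" if "x \<in> set (ypar K p)" for x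
      using that ypar_vars by blast
    have "vs = map \<sigma>' (ybar K (IA, p))"
      using eq by (simp add: us delta_tuple_map)
    moreover have "eval \<sigma>' (domain_restr K IA (ybar K (IA, p)))"
      using eq \<sigma> unfolding eval_domain_restr_IA[OF \<sigma>'] assignment_def by blast
    ultimately show ?thesis
      using that \<sigma>' IA by blast
  qed
qed

end

section \<open>Semantics of encodings\<close>

lemma consequences_mono: "(\<And>q. P q \<subseteq> P' q) \<Longrightarrow> consequences \<Psi> P p \<subseteq> consequences \<Psi> P' p"
  unfolding consequences_def body_holds_def by fast

lemma consequences_Un: "consequences (\<Psi> \<union> \<Psi>') P p = consequences \<Psi> P p \<union> consequences \<Psi>' P p"
  unfolding consequences_def by blast

lemma consequences_query: "is_query C \<Longrightarrow> consequences {C} P p = {}"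
  by (auto simp: consequences_def is_query_def)

lemma enc_sem_upto_Suc: "enc_sem_upto K E n s \<subseteq> enc_sem_upto K E (Suc n) s"
proof (induction n arbitrary: s)
  case 0
  then show ?case
    using consequences_mono[of "\<lambda>_. {}"] by (cases s) fastforce
next
  case (Suc n)
  obtain a p where s: "s = (a, p)"
    by fastforce
  have "consequences (fragment E a) (enc_sem_upto K E n) s
      \<subseteq> consequences (fragment E a) (enc_sem_upto K E (Suc n)) s"
    by (intro consequences_mono Suc)
  moreover have "transport K a p (enc_sem_upto K E n (other a, p))
      \<subseteq> transport K a p (enc_sem_upto K E (Suc n) (other a, p))"
    by (intro transport_mono Suc)
  ultimately show ?case
    unfolding enc_sem_upto.simps(2)[of K E n] enc_sem_upto.simps(2)[of K E "Suc n"] s by auto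
qed

lemma enc_sem_upto_mono: "m \<le> n \<Longrightarrow> enc_sem_upto K E m s \<subseteq> enc_sem_upto K E n s"
  by (rule lift_Suc_mono_le[of "\<lambda>n. enc_sem_upto K E n s"]) (rule enc_sem_upto_Suc)

text \<open>Continuity: a body has finitely many atoms and the stages form a chain, so the largest
  of the stages at which the single atoms hold serves for all of them.\<close>

lemma body_holds_enc_sem:
  assumes "body_holds (enc_sem K E) \<sigma> C"
  obtains n where "body_holds (enc_sem_upto K E n) \<sigma> C"
proof -
  have "\<exists>n. \<forall>(s, xs)\<in>set As. map \<sigma> xs \<in> enc_sem_upto K E n s"
    if "\<forall>(s, xs)\<in>set As. map \<sigma> xs \<in> enc_sem K E s" for As
    using that
  proof (induction As)
    case (Cons A As)
    obtain s xs where A: "A = (s, xs)"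
      by fastforce
    from Cons obtain m where "\<forall>(s, xs)\<in>set As. map \<sigma> xs \<in> enc_sem_upto K E m s"
      by auto
    moreover from Cons.prems A obtain n where "map \<sigma> xs \<in> enc_sem_upto K E n s"
      by (auto simp: enc_sem_def)
    ultimately have "\<forall>(s, xs)\<in>set (A # As). map \<sigma> xs \<in> enc_sem_upto K E (max m n) s"
      using enc_sem_upto_mono[of m "max m n" K E] enc_sem_upto_mono[of n "max m n" K E] A
      by fastforce
    then show ?case
      by blast
  qed simp
  then show thesis
    using assms that unfolding body_holds_def by blast
qed

text \<open>With \<open>transport_enc_sem\<close>, this makes the limit semantics closed under both
  ways of producing tuples. A body true in the limit is true at some stage, and its head tuple
  appears one stage later.\<close>

lemma consequences_enc_sem:
  "consequences (fragment E a) (enc_sem K E) (a, p) \<subseteq> enc_sem K E (a, p)"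
proof
  fix vs assume "vs \<in> consequences (fragment E a) (enc_sem K E) (a, p)"
  then obtain \<sigma> xs C where *: "vs = map \<sigma> xs" "C \<in> fragment E a" "head C = Some ((a, p), xs)"
    "assignment \<sigma>" "body_holds (enc_sem K E) \<sigma> C"
    by (auto simp: consequences_def)
  obtain n where "body_holds (enc_sem_upto K E n) \<sigma> C"
    using body_holds_enc_sem *(5) .
  then have "vs \<in> enc_sem_upto K E (Suc n) (a, p)"
    using * by (auto simp: consequences_def)
  then show "vs \<in> enc_sem K E (a, p)"
    unfolding enc_sem_def by blast
qed

lemma transport_enc_sem:
  assumes "((other a, p), (a, p)) \<in> interface E"
  shows "transport K a p (enc_sem K E (other a, p)) \<subseteq> enc_sem K E (a, p)"
proof -
  have "transport K a p (enc_sem_upto K E n (other a, p)) \<subseteq> enc_sem_upto K E (Suc n) (a, p)" for n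
    using assms by simp
  then show ?thesis
    unfolding enc_sem_def transport_UN by blast
qed

section \<open>Adding a query to an encoding\<close>

lemma fragment_add_BV_query:
  "fragment (add_BV_query C E) a = (if a = BV then fragment E a \<union> {C} else fragment E a)"
  by (cases E; cases a) auto

lemma interface_add_BV_query: "interface (add_BV_query C E) = interface E"
  by (cases E) auto

lemma enc_sem_add_BV_query:
  assumes "is_query C"
  shows "enc_sem K (add_BV_query C E) = enc_sem K E"
proof -
  have cons: "consequences (fragment (add_BV_query C E) a) = consequences (fragment E a)" for a
    using assms by (intro ext) (simp add: fragment_add_BV_query consequences_Un consequences_query
        del: Un_insert_right)
  have "enc_sem_upto K (add_BV_query C E) n = enc_sem_upto K E n" for n
    by (induction n) (simp_all only: enc_sem_upto.simps cons interface_add_BV_query)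
  then show ?thesis
    unfolding enc_sem_def by presburger
qed

text \<open>Isolates what the semantic arguments take from the construction of an encoding:
  fragments do not mix copies, and arguments can be substituted for formal parameters.\<close>

definition wf_encoding :: "'p setting \<Rightarrow> 'p encoding \<Rightarrow> bool" where
  "wf_encoding K E \<longleftrightarrow> (\<forall>a. \<forall>C\<in>fragment E a. \<forall>(s, xs)\<in>atoms C.
     fst s = a \<and> map vsort xs = map vsort (ybar K s))"

lemma wf_encodingD:
  "wf_encoding K E \<Longrightarrow> C \<in> fragment E a \<Longrightarrow> (s, xs) \<in> atoms C \<Longrightarrow>
    fst s = a \<and> map vsort xs = map vsort (ybar K s)"
  unfolding wf_encoding_def by blast

lemma wf_encoding_encoding:
  assumes wf: "wf_setting K" and "wf_chcs K \<Phi>" and "\<Delta> \<subseteq> \<Phi>"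
  shows "wf_encoding K (encoding K \<Phi> \<Delta>)"
proof -
  have "fst s = a \<and> map vsort xs = map vsort (ybar K s)"
    if C: "C \<in> fragment (encoding K \<Phi> \<Delta>) a" and A: "(s, xs) \<in> atoms C" for a C s xs
  proof -
    have sorts: "map vsort ys = map vsort (ypar K p)" if "D \<in> \<Phi>" "(p, ys) \<in> atoms D" for D p ys
      using that assms(2) wf by (fastforce simp: wf_chcs_def wf_chc_def wf_setting_def)
    show ?thesis
    proof (cases a)
      case BV
      then obtain D where "D \<in> \<Phi>" "C = map_chc (Pair BV) D"
        using C assms(3) by (auto simp: encoding_def to_BV_def)
      then obtain p where "s = (BV, p)" "(p, xs) \<in> atoms D"
        using A by (cases D) (auto simp: atoms_def)
      then show ?thesis
        using sorts \<open>D \<in> \<Phi>\<close> BV by simp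
    next
      case IA
      then obtain D where D: "D \<in> \<Phi>" "C = to_IA K D"
        using C by (auto simp: encoding_def)
      then obtain p ys where p: "s = (IA, p)" "xs = map (prime K) ys" "(p, ys) \<in> atoms D"
        using A by (auto simp: atoms_def to_IA_def)
      have eq: "map vsort ys = map vsort (ypar K p)"
        using sorts D p by blast
      have int: "vsort (prime K x) = IntSort" if "x \<in> set ys \<union> set (ypar K p)" for x
      proof -
        have "vsort x \<in> vsort ` set (ypar K p)"
          using that eq by (metis Un_iff imageI list.set_map)
        then show ?thesis
          using ypar_vars[OF wf, of p] vsort_prime[OF wf, of x] by (auto simp: vars_of_thy_def)
      qed
      \<comment> \<open>Priming collapses all sorts to \<open>IntSort\<close>, so only the lengths
        of the two lists remain to be compared.\<close>
      have "map (\<lambda>x. vsort (prime K x)) ys = map (\<lambda>_. IntSort) ys"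
        and "map (\<lambda>x. vsort (prime K x)) (ypar K p) = map (\<lambda>_. IntSort) (ypar K p)"
        using int by simp_all
      moreover have "length ys = length (ypar K p)"
        using eq map_eq_imp_length_eq by blast
      ultimately show ?thesis
        using p IA by (simp add: comp_def map_replicate_const)
    qed
  qed
  then show ?thesis
    unfolding wf_encoding_def by blast
qed

text \<open>Supplies the domain condition of \<open>eval_domain_restr_transport\<close>: local
  tuples come from well-sorted assignments, external ones from \<open>delta_pre\<close>.\<close>

lemma enc_sem_upto_BV_domain:
  assumes "wf_encoding K E"
  shows "enc_sem_upto K E n (BV, p) \<subseteq> domain_tuples (ypar K p)"
proof -
  have "consequences (fragment E BV) P (BV, p) \<subseteq> domain_tuples (ypar K p)" for P
  proof
    fix vs assume "vs \<in> consequences (fragment E BV) P (BV, p)"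
    then obtain \<sigma> xs C where *: "vs = map \<sigma> xs" "C \<in> fragment E BV" "head C = Some ((BV, p), xs)"
      "assignment \<sigma>"
      by (auto simp: consequences_def)
    then have "map vsort xs = map vsort (ypar K p)"
      using wf_encodingD[OF assms *(2), of "(BV, p)" xs] by (auto simp: atoms_def)
    then show "vs \<in> domain_tuples (ypar K p)"
      using * map_in_domain_tuples by blast
  qed
  then show ?thesis
    by (cases n) (auto simp: delta_pre_def)
qed

section \<open>Soundness of the lemma sets\<close>

text \<open>Finiteness makes \<open>list_of\<close> enumerate the lemmas. The bound concerns the
  limit semantics of the other copy rather than a stage, and it covers predicates outside the
  interface too, because obligations may be about any predicate.\<close>

definition over_sound :: "'p setting \<Rightarrow> 'p encoding \<Rightarrow> 'p lemmas_set \<Rightarrow> bool" where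
  "over_sound K E L \<longleftrightarrow> finite L \<and> (\<forall>((a, p), \<psi>)\<in>L. set_fm \<psi> \<subseteq> set (ybar K (a, p)) \<and>
     transport K a p (enc_sem K E (other a, p)) \<subseteq> solutions \<psi> (ybar K (a, p)))"

definition under_sound :: "'p setting \<Rightarrow> 'p encoding \<Rightarrow> 'p lemmas_set \<Rightarrow> bool" where
  "under_sound K E L \<longleftrightarrow> finite L \<and> (\<forall>((a, p), \<psi>)\<in>L.
     solutions (Conj \<psi> (domain_restr K a (ybar K (a, p)))) (ybar K (a, p))
       \<subseteq> transport K a p (enc_sem K E (other a, p)))"

text \<open>Induction on stages within the single theory \<open>a\<close>. Local tuples stay inside
  \<open>J\<close> because \<open>J\<close> validates the fragment; external tuples satisfy all
  lemmas and the domain restriction, so the added facts place them in \<open>J\<close>. The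
  invariant bounds the external part at every stage, which avoids a mutual induction with the other
  theory. \<open>\<Psi>\<close> leaves room for the query.\<close>

lemma enc_sem_subset_solution:
  assumes wf: "wf_setting K" and wfE: "wf_encoding K E" and sound: "over_sound K E L"
    and solves: "solves K a J (with_over K E a L \<union> \<Psi>)"
  shows "enc_sem K E (a, p) \<subseteq> solutions (J (a, p)) (ybar K (a, p))"
proof -
  have vars: "set_fm (J (a, p)) \<subseteq> set (ybar K (a, p))" for p
    using solves by (simp add: solves_def interpretation_over_def)
  have atom: "eval \<sigma> (inst_atom K J ((a, p), xs)) \<longleftrightarrow>
      map \<sigma> xs \<in> solutions (J (a, p)) (ybar K (a, p))"
    if "assignment \<sigma>" "map vsort xs = map vsort (ybar K (a, p))" for \<sigma> xs p
    using that distinct_ybar[OF wf] vars by (intro eval_inst_atom)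
  have local: "consequences (fragment E a) P (a, p) \<subseteq> solutions (J (a, p)) (ybar K (a, p))"
    if P: "\<And>p. P (a, p) \<subseteq> solutions (J (a, p)) (ybar K (a, p))" for P p
  proof
    fix vs assume "vs \<in> consequences (fragment E a) P (a, p)"
    then obtain \<sigma> xs C where *: "vs = map \<sigma> xs" "C \<in> fragment E a" "head C = Some ((a, p), xs)"
      "assignment \<sigma>" "body_holds P \<sigma> C"
      by (auto simp: consequences_def)
    have wfC: "fst s = a \<and> map vsort zs = map vsort (ybar K s)" if "(s, zs) \<in> atoms C" for s zs
      using wf_encodingD[OF wfE *(2) that] .
    have "eval \<sigma> (inst_atom K J A)" if A: "A \<in> set (body C)" for A
    proof -
      obtain b r zs where [simp]: "A = ((b, r), zs)"
        by (metis surj_pair)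
      have "fst (b, r) = a \<and> map vsort zs = map vsort (ybar K (b, r))"
        using A by (intro wfC) (simp add: atoms_def)
      moreover have "map \<sigma> zs \<in> P (b, r)"
        using A *(5) by (auto simp: body_holds_def)
      ultimately show ?thesis
        using P[of r] atom[OF *(4), of zs r] by auto
    qed
    moreover have "eval \<sigma> (inst_chc K J C)"
      using solves *(2,4) by (auto simp: solves_def with_over_def valid_def)
    ultimately have "eval \<sigma> (inst_atom K J ((a, p), xs))"
      using *(3,5) by (auto simp: inst_chc_def eval_big_conj body_holds_def)
    moreover have "map vsort xs = map vsort (ybar K (a, p))"
      using wfC *(3) by (auto simp: atoms_def)
    ultimately show "vs \<in> solutions (J (a, p)) (ybar K (a, p))"
      using atom *(1,4) by blast
  qed
  have external: "transport K a p (enc_sem_upto K E n (other a, p))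
      \<subseteq> solutions (J (a, p)) (ybar K (a, p))"
    if iface: "((other a, p), (a, p)) \<in> interface E" for n p
  proof
    fix vs assume vs: "vs \<in> transport K a p (enc_sem_upto K E n (other a, p))"
    obtain \<sigma> where \<sigma>: "assignment \<sigma>" and eq: "vs = map \<sigma> (ybar K (a, p))"
      and R: "eval \<sigma> (domain_restr K a (ybar K (a, p)))"
      by (rule eval_domain_restr_transport[OF wf _ vs])
        (use enc_sem_upto_BV_domain[OF wfE, of n p] in auto)
    \<comment> \<open>The invariant speaks of the limit, so the stage is first enlarged to
      it.\<close>
    have "transport K a p (enc_sem_upto K E n (other a, p))
        \<subseteq> transport K a p (enc_sem K E (other a, p))"
      by (rule transport_mono) (auto simp: enc_sem_def)
    then have vs': "vs \<in> transport K a p (enc_sem K E (other a, p))"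
      using vs by blast
    have "eval \<sigma> \<psi>" if "((a, p), \<psi>) \<in> L" for \<psi>
    proof -
      have "set_fm \<psi> \<subseteq> set (ybar K (a, p))" and "vs \<in> solutions \<psi> (ybar K (a, p))"
        using that sound vs' by (auto simp: over_sound_def)
      then show ?thesis
        using eq map_in_solutions_iff[OF \<sigma>] by blast
    qed
    then have "eval \<sigma> (big_conj (lemmas_for L (a, p)))"
      using sound by (simp add: over_sound_def eval_big_conj set_lemmas_for)
    moreover have "eval \<sigma> (inst_chc K J (CHC (Conj (big_conj (lemmas_for L (a, p)))
        (domain_restr K a (ybar K (a, p)))) [] (Some ((a, p), ybar K (a, p)))))"
      using solves iface \<sigma> unfolding solves_def with_over_def valid_def by blast
    ultimately have "eval \<sigma> (inst_atom K J ((a, p), ybar K (a, p)))"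
      using R by (simp add: inst_chc_def big_conj_def)
    then show "vs \<in> solutions (J (a, p)) (ybar K (a, p))"
      using atom \<sigma> eq by blast
  qed
  have "enc_sem_upto K E n (a, p) \<subseteq> solutions (J (a, p)) (ybar K (a, p))" for n p
  proof (induction n arbitrary: p)
    case 0
    then show ?case
      using local[of "\<lambda>_. {}"] by simp
  next
    case (Suc n)
    then show ?case
      using local[of "enc_sem_upto K E n"] external by simp
  qed
  then show ?thesis
    unfolding enc_sem_def by blast
qed

text \<open>The encoding semantics is closed under the rules of the fragment and under the added
  facts, since the restricted solutions of each lemma lie in the transported part. The single-theory
  semantics is the least such relation, hence contained in it; queries derive nothing.\<close>

lemma chc_sem_subset_enc_sem:
  assumes wfE: "wf_encoding K E" and sound: "under_sound K E L"
    and queries: "\<And>C. C \<in> \<Psi> \<Longrightarrow> is_query C"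
  shows "chc_sem (with_under K E a L \<union> \<Psi>) (a, p) \<subseteq> enc_sem K E (a, p)"
proof -
  have step: "consequences (with_under K E a L \<union> \<Psi>) P (a, p) \<subseteq> enc_sem K E (a, p)"
    if P: "\<And>p. P (a, p) \<subseteq> enc_sem K E (a, p)" for P p
  proof
    fix vs assume "vs \<in> consequences (with_under K E a L \<union> \<Psi>) P (a, p)"
    then obtain \<sigma> xs C where *: "vs = map \<sigma> xs" "C \<in> with_under K E a L \<union> \<Psi>"
      "head C = Some ((a, p), xs)" "assignment \<sigma>" "body_holds P \<sigma> C"
      by (auto simp: consequences_def)
    then have "C \<in> with_under K E a L"
      using queries by (auto simp: is_query_def)
    then consider (local) "C \<in> fragment E a"
      | (external) "C = CHC (Conj (big_disj (lemmas_for L (a, p)))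
          (domain_restr K a (ybar K (a, p)))) [] (Some ((a, p), ybar K (a, p)))"
          "((other a, p), (a, p)) \<in> interface E" "xs = ybar K (a, p)"
      using *(3) by (auto simp: with_under_def)
    then show "vs \<in> enc_sem K E (a, p)"
    proof cases
      case local
      then have "fst s = a" if "(s, zs) \<in> set (body C)" for s zs
        using wf_encodingD[OF wfE local, of s zs] that by (auto simp: atoms_def)
      then have "body_holds (enc_sem K E) \<sigma> C"
        using *(5) P unfolding body_holds_def by fastforce
      then have "vs \<in> consequences (fragment E a) (enc_sem K E) (a, p)"
        using * local by (auto simp: consequences_def)
      then show ?thesis
        by (rule subsetD[OF consequences_enc_sem])
    next
      case external
      then obtain \<psi> where \<psi>: "((a, p), \<psi>) \<in> L" "eval \<sigma> \<psi>"
        and "eval \<sigma> (domain_restr K a (ybar K (a, p)))"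
        using *(5) sound by (auto simp: body_holds_def eval_big_disj set_lemmas_for under_sound_def)
      then have "vs \<in> solutions (Conj \<psi> (domain_restr K a (ybar K (a, p)))) (ybar K (a, p))"
        using *(1,4) external by (auto simp: solutions_def)
      then have "vs \<in> transport K a p (enc_sem K E (other a, p))"
        using sound \<psi>(1) by (auto simp: under_sound_def)
      then show ?thesis
        by (rule subsetD[OF transport_enc_sem[OF external(2)]])
    qed
  qed
  have "chc_sem_upto (with_under K E a L \<union> \<Psi>) n (a, p) \<subseteq> enc_sem K E (a, p)" for n p
    by (induction n arbitrary: p) (simp_all add: step)
  then show ?thesis
    unfolding chc_sem_def by blast
qed

section \<open>Preservation of the invariant by the transitions\<close>

lemma refutation_child:
  assumes "wf_encoding K E" and "under_sound K E L"
    and ref: "refutation K a (with_under K E a L \<union> query_for K ((a, p), \<phi>)) g \<pi>"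
    and t: "t \<in> set (children \<pi>)" "label t = Some ((a, p), \<psi>)"
  shows "qf a \<psi>" and "set_fm \<psi> \<subseteq> set (ybar K (a, p))"
    and "solutions \<psi> (ybar K (a, p)) \<subseteq> enc_sem K E (a, p)"
proof -
  let ?\<Psi> = "with_under K E a L \<union> query_for K ((a, p), \<phi>)"
  have "t \<in> nodes t"
    by (cases t) simp
  then have "wf_node K a ?\<Psi> t"
    using ref t(1) by (auto simp: refutation_def proper_nodes_def split: prod.splits)
  moreover have "chc_sem ?\<Psi> (a, p) \<subseteq> enc_sem K E (a, p)"
    using assms(1,2) by (rule chc_sem_subset_enc_sem) (simp add: query_for_def is_query_def)
  ultimately show "qf a \<psi>" "set_fm \<psi> \<subseteq> set (ybar K (a, p))"
    "solutions \<psi> (ybar K (a, p)) \<subseteq> enc_sem K E (a, p)"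
    using t(2) by (auto simp: wf_node_def)
qed

lemma solve_step_sound:
  assumes wf: "wf_setting K" and wfE: "wf_encoding K E"
    and "solve_step K E g S S'"
    and "under_sound K E (fst (snd S))" and "over_sound K E (snd (snd S))"
  shows "under_sound K E (fst (snd S')) \<and> over_sound K E (snd (snd S'))"
  using assms(3)
proof cases
  case (NegAnswer a p \<phi> Q J L U)
  have over: "over_sound K E L" and under: "under_sound K E U"
    using assms(4,5) NegAnswer by simp_all
  have qf: "qf a (J (a, p))" and sub: "set_fm (J (a, p)) \<subseteq> set (ybar K (a, p))"
    using NegAnswer by (simp_all add: solves_def interpretation_over_def)
  have "enc_sem K E (a, p) \<subseteq> solutions (J (a, p)) (ybar K (a, p))"
    using enc_sem_subset_solution[OF wf wfE over] NegAnswer by blast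
  then have "transport K (other a) p (enc_sem K E (a, p))
      \<subseteq> transport K (other a) p (solutions (J (a, p)) (ybar K (a, p)))"
    by (rule transport_mono)
  \<comment> \<open>Dropping the domain restriction only adds solutions, which an over-approximation
    tolerates.\<close>
  also have "\<dots> \<subseteq> solutions (tau K a (J (a, p))) (ybar K (other a, p))"
    unfolding solutions_tau[OF wf qf sub, symmetric] by (auto simp: solutions_def)
  finally show ?thesis
    using NegAnswer over under set_fm_tau[OF wf qf sub] by (simp add: over_sound_def)
next
  case (PosAnswer a p \<phi> Q U \<pi> t \<psi> L)
  have over: "over_sound K E L" and under: "under_sound K E U"
    using assms(4,5) PosAnswer by simp_all
  note child = refutation_child[OF wfE under PosAnswer(4-6)]
  have "transport K (other a) p (solutions \<psi> (ybar K (a, p)))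
      \<subseteq> transport K (other a) p (enc_sem K E (a, p))"
    using child(3) by (rule transport_mono)
  then show ?thesis
    using PosAnswer over under by (simp add: under_sound_def solutions_tau[OF wf child(1,2)])
next
  case Query
  then show ?thesis
    using assms(4,5) by (simp only: fst_conv snd_conv)
qed

lemma solve_steps_sound:
  assumes "wf_setting K" and "wf_encoding K E"
    and "(solve_step K E g)\<^sup>*\<^sup>* (Q, {}, {}) S"
  shows "under_sound K E (fst (snd S)) \<and> over_sound K E (snd (snd S))"
  using assms(3)
proof (induction rule: rtranclp_induct)
  case base
  show ?case
    by (simp add: under_sound_def over_sound_def)
next
  case (step S S')
  then show ?case
    using solve_step_sound[OF assms(1,2)] by blast
qed

section \<open>Soundness of the returned answers\<close>

theorem theorem4:
  fixes K :: "'p setting" and \<Phi> \<Delta>\<^sub>B\<^sub>V :: "'p chc set" and E :: "'p encoding"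
    and q :: 'p and \<phi>\<^sub>q :: form and \<chi>\<^sub>q :: "'p pcopy chc"
  assumes "wf_setting K"
    and "wf_chcs K \<Phi>"
    and "\<Delta>\<^sub>B\<^sub>V \<subseteq> \<Phi>"
    and "E = encoding K \<Phi> \<Delta>\<^sub>B\<^sub>V"
    and "\<forall>a. \<forall>C\<in>fragment E a. \<not> is_query C"
    and "qf BV \<phi>\<^sub>q" and "set_fm \<phi>\<^sub>q \<subseteq> set (ybar K (BV, q))"
    and "\<chi>\<^sub>q = CHC \<phi>\<^sub>q [((BV, q), ybar K (BV, q))] None"
  shows "(solve_returns K E ((BV, q), \<phi>\<^sub>q) SAT \<longrightarrow> enc_satisfiable K (add_BV_query \<chi>\<^sub>q E)) \<and>
         (solve_returns K E ((BV, q), \<phi>\<^sub>q) UNSAT \<longrightarrow> \<not> enc_satisfiable K (add_BV_query \<chi>\<^sub>q E))"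
proof -
  let ?ys = "ybar K (BV, q)"
  let ?g = "((BV, q), \<phi>\<^sub>q)"
  have wfE: "wf_encoding K E"
    using wf_encoding_encoding[OF assms(1-3)] by (simp only: assms(4))
  have query: "is_query \<chi>\<^sub>q"
    by (simp add: assms(8) is_query_def)
  \<comment> \<open>The fragments contain no query, and adding one leaves the semantics unchanged,
    so satisfiability reduces to the truth of \<open>\<chi>\<^sub>q\<close> in the semantics of
    \<open>E\<close>.\<close>
  have iff: "enc_satisfiable K (add_BV_query \<chi>\<^sub>q E) \<longleftrightarrow>
      (\<forall>\<sigma>. assignment \<sigma> \<and> eval \<sigma> \<phi>\<^sub>q \<longrightarrow> map \<sigma> ?ys \<notin> enc_sem K E (BV, q))"
  proof -
    have "enc_satisfiable K (add_BV_query \<chi>\<^sub>q E) \<longleftrightarrow> query_true (enc_sem K E) \<chi>\<^sub>q"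
      using assms(5) query
      by (auto simp: enc_satisfiable_def enc_sem_add_BV_query fragment_add_BV_query
          split: if_splits)
    then show ?thesis
      by (auto simp: query_true_def body_holds_def assms(8))
  qed
  have "enc_satisfiable K (add_BV_query \<chi>\<^sub>q E)" if "solve_returns K E ?g SAT"
  proof -
    obtain S where "(solve_step K E ?g)\<^sup>*\<^sup>* ({?g}, {}, {}) S" and "state_returns K E ?g S SAT"
      using \<open>solve_returns K E ?g SAT\<close> by (auto simp: solve_returns_def)
    moreover from this obtain J U L where S: "S = ({?g}, U, L)"
      and J: "solves K BV J (with_over K E BV L \<union> query_for K ?g)"
      by (auto elim: state_returns.cases)
    ultimately have over: "over_sound K E L"
      using solve_steps_sound[OF assms(1) wfE, of ?g "{?g}" S] by simp
    have sub: "enc_sem K E (BV, q) \<subseteq> solutions (J (BV, q)) ?ys"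
      using enc_sem_subset_solution[OF assms(1) wfE over J] .
    have vars: "set_fm (J (BV, q)) \<subseteq> set ?ys"
      using J by (simp add: solves_def interpretation_over_def)
    have "map \<sigma> ?ys \<notin> enc_sem K E (BV, q)" if \<sigma>: "assignment \<sigma>" "eval \<sigma> \<phi>\<^sub>q" for \<sigma>
    proof -
      \<comment> \<open>The query clause solved by \<open>J\<close> is \<open>\<chi>\<^sub>q\<close>
        with the trivial restriction \<open>Top\<close> added; its validity makes \<open>J\<close>
        for \<open>q\<close> disjoint from \<open>\<phi>\<^sub>q\<close>.\<close>
      have "eval \<sigma> (inst_chc K J (CHC (Conj \<phi>\<^sub>q (domain_restr K BV ?ys)) [((BV, q), ?ys)] None))"
        using J \<sigma>(1) by (simp add: solves_def query_for_def valid_def)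
      then have "\<not> eval \<sigma> (inst_atom K J ((BV, q), ?ys))"
        using \<sigma>(2) by (simp add: inst_chc_def big_conj_def)
      then have "map \<sigma> ?ys \<notin> solutions (J (BV, q)) ?ys"
        using eval_inst_atom[where s = "(BV, q)" and J = J,
            OF distinct_ybar[OF assms(1)] refl \<sigma>(1) vars]
        by blast
      then show ?thesis
        using sub by blast
    qed
    then show ?thesis
      unfolding iff by blast
  qed
  moreover have "\<not> enc_satisfiable K (add_BV_query \<chi>\<^sub>q E)" if "solve_returns K E ?g UNSAT"
  proof -
    obtain S where "(solve_step K E ?g)\<^sup>*\<^sup>* ({?g}, {}, {}) S" and "state_returns K E ?g S UNSAT"
      using \<open>solve_returns K E ?g UNSAT\<close> by (auto simp: solve_returns_def)
    moreover from this obtain \<pi> U L where S: "S = ({?g}, U, L)"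
      and \<pi>: "refutation K BV (with_under K E BV U \<union> query_for K ?g) ?g \<pi>"
      by (auto elim: state_returns.cases)
    ultimately have under: "under_sound K E U"
      using solve_steps_sound[OF assms(1) wfE, of ?g "{?g}" S] by simp
    \<comment> \<open>The child of the root provides the counterexample: its label lies inside the
      semantics of \<open>q\<close> and meets \<open>\<phi>\<^sub>q\<close>.\<close>
    from \<pi> obtain t \<psi> where t: "t \<in> set (children \<pi>)" "label t = Some ((BV, q), \<psi>)"
      and "satisfiable (Conj \<psi> \<phi>\<^sub>q)"
      by (auto simp: refutation_def)
    then obtain \<sigma> where \<sigma>: "assignment \<sigma>" "eval \<sigma> \<psi>" "eval \<sigma> \<phi>\<^sub>q"
      by (auto simp: satisfiable_def)
    then have "map \<sigma> ?ys \<in> enc_sem K E (BV, q)"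
      using refutation_child(3)[OF wfE under \<pi> t] by (auto simp: solutions_def)
    then show ?thesis
      using iff \<sigma> by blast
  qed
  ultimately show ?thesis
    by blast
qed

end
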